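(* For every positive integer $k$, in $\mathbb C[[\mathbf t]]$, \[ \sum_{n\ge0}\sum_{\underline\mu\vdash n}\frac{\mathrm{roots}_k^{\prime B_n}(\underline\mu)}{|Z_{\underline\mu}|}\mathbf t^{\mathbf c(\underline\mu)}=\exp\Big(\sum_{j,\theta}\sum_{\substack{h\mid k\\ \gcd(h,j)=1}}\frac{-(-t_{j,\theta})^{jk/h}}{2jk/h}\,\mathrm{roots}_h^{\mathbb Z_2}(\theta)\Big) \] and \[ \sum_{n\ge0}\sum_{\underline\mu\vdash n}\frac{\mathrm{sroots}_k^{\prime B_n}(\underline\mu)}{|Z_{\underline\mu}|}\mathbf t^{\mathbf c(\underline\mu)}=\exp\Big(\sum_{j,\theta}\sum_{\substack{h\mid k\\ \gcd(h,j)=1}}\frac{-(-t_{j,\theta})^{jk/h}}{2jk/h}\,\mathrm{sroots}_h^{\mathbb Z_2}(\theta)\Big), \] where $h$ runs over positive divisors of $k$, $j\ge1$ and $\theta\in\mathbb Z_2$.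
   Context: $B_n$ is the group of bijections $w$ of $\{\pm1,\dots,\pm n\}$ with $w(-i)=-w(i)$. $\chi(w)=\prod_{i=1}^n\mathrm{sign}(w(i))$ and $\chi'(w)=\mathrm{sign}(|w|)$, the sign of the permutation $|w|(i)=|w(i)|$ in $S_n$. Define $\mathrm{roots}_k^{\prime B_n}(y)=\sum_{x\in B_n,\,x^k=y}\chi'(x)$ and $\mathrm{sroots}_k^{\prime B_n}(y)=\sum_{x\in B_n,\,x^k=y}\chi(x)\chi'(x)$. Cycles: if $c$ is a cycle of $w$ on $\{\pm1,\dots,\pm n\}$ of length $\ell$, so is $\bar c$ (negated entries); if $c\ne\bar c$, $c\bar c$ is a cycle of length $\ell$ and class $+1$; if $c=\bar c$, a cycle of length $\ell/2$ and class $-1$. Conjugacy classes are indexed by bipartitions $\underline\mu=(\mu^+,\mu^-)\vdash n$ ($\mu^\theta$ = lengths of cycles of class $\theta$); $b_{j,\theta}$ = number of parts $j$ of $\mu^\theta$; $\mathbf t^{\mathbf c(\underline\mu)}=\prod t_{j,\theta}^{jb_{j,\theta}}$. Values at $\underline\mu$ mean values at an element of that class, $|Z_{\underline\mu}|$ its centralizer order. $\mathbb Z_2=\{\pm1\}$, $\mathrm{roots}_h^{\mathbb Z_2}(\theta)=|\{\varepsilon:\varepsilon^h=\theta\}|$, $\mathrm{sroots}_h^{\mathbb Z_2}(\theta)=\sum_{\varepsilon^h=\theta}\varepsilon$. *)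

theory Defs
  imports
    Complex_Main
    "HOL-Library.Poly_Mapping"
    "HOL-Library.Multiset"
    "HOL-Combinatorics.Permutations"
    "HOL-Combinatorics.Orbits"
    "HOL-Algebra.Group"
begin

section \<open>Formal power series in arbitrarily many variables\<close>

text \<open>
  A series over the variables \<open>'v\<close> is an arbitrary family of coefficients indexed by the
  monomials, a monomial being a finitely supported exponent function.
\<close>

typedef (overloaded) ('v, 'a) mps = "UNIV :: (('v \<Rightarrow>\<^sub>0 nat) \<Rightarrow> 'a) set"
  morphisms mps_coeff Abs_mps
  by simp

lemma mps_coeff_Abs [simp]: "mps_coeff (Abs_mps f) = f"
  by (simp add: Abs_mps_inverse)

lemma mps_eqI: "(\<And>m. mps_coeff f m = mps_coeff g m) \<Longrightarrow> f = g"
  by (metis ext mps_coeff_inject)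

definition mono_splits :: "('v \<Rightarrow>\<^sub>0 nat) \<Rightarrow> (('v \<Rightarrow>\<^sub>0 nat) \<times> ('v \<Rightarrow>\<^sub>0 nat)) set" where
  "mono_splits m = {(a, b). a + b = m}"

lemma finite_mono_splits [simp]: "finite (mono_splits m)"
proof -
  let ?K = "Poly_Mapping.keys m" and ?L = "Poly_Mapping.lookup m"
  let ?B = "{f. \<forall>x. (x \<in> ?K \<longrightarrow> f x \<in> {..Max (?L ` ?K)}) \<and> (x \<notin> ?K \<longrightarrow> f x = 0)}"
  have fin: "finite ?B" by (intro finite_set_of_finite_funs) simp_all
  have B: "Poly_Mapping.lookup a \<in> ?B" if "a + b = m" for a b
  proof -
    have le: "Poly_Mapping.lookup a x \<le> ?L x" for x
      using that by (auto simp: lookup_add)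
    have "?L x \<le> Max (?L ` ?K)" if "x \<in> ?K" for x
      using that by (intro Max_ge) auto
    with le have "Poly_Mapping.lookup a x \<le> Max (?L ` ?K)" if "x \<in> ?K" for x
      using that order_trans by blast
    moreover have "Poly_Mapping.lookup a x = 0" if "x \<notin> ?K" for x
      using that le[of x] by (simp add: in_keys_iff)
    ultimately show ?thesis by simp
  qed
  have sub: "Poly_Mapping.lookup ` fst ` mono_splits m \<subseteq> ?B"
    unfolding image_image
  proof (rule image_subsetI)
    fix p assume "p \<in> mono_splits m"
    then have "fst p + snd p = m" by (simp add: mono_splits_def case_prod_unfold)
    then show "Poly_Mapping.lookup (fst p) \<in> ?B" by (rule B)
  qed
  have "finite (Poly_Mapping.lookup ` fst ` mono_splits m)"
    using fin sub by (rule rev_finite_subset)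
  then have "finite (fst ` mono_splits m)"
    by (rule finite_imageD) (rule inj_onI, rule poly_mapping_eqI, simp)
  moreover have "inj_on fst (mono_splits m)"
    by (auto simp: inj_on_def mono_splits_def)
  ultimately show ?thesis by (rule finite_imageD)
qed

instantiation mps :: (type, comm_ring_1) comm_ring_1
begin

definition "0 = Abs_mps (\<lambda>m. 0)"
definition "1 = Abs_mps (\<lambda>m. if m = 0 then 1 else 0)"
definition "f + g = Abs_mps (\<lambda>m. mps_coeff f m + mps_coeff g m)"
definition "- f = Abs_mps (\<lambda>m. - mps_coeff f m)"
definition "f - g = Abs_mps (\<lambda>m. mps_coeff f m - mps_coeff g m)"
definition "f * g = Abs_mps (\<lambda>m. \<Sum>(a, b)\<in>mono_splits m. mps_coeff f a * mps_coeff g b)"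

instance
proof
  fix f g h :: "('a, 'b) mps"
  show "f * g = g * f"
  proof (rule mps_eqI)
    fix m
    have "(\<Sum>(a, b)\<in>mono_splits m. mps_coeff f a * mps_coeff g b) =
          (\<Sum>(a, b)\<in>mono_splits m. mps_coeff g a * mps_coeff f b)"
      by (rule sum.reindex_bij_witness[of _ "\<lambda>(a,b). (b,a)" "\<lambda>(a,b). (b,a)"])
         (auto simp: mono_splits_def ac_simps)
    then show "mps_coeff (f * g) m = mps_coeff (g * f) m"
      by (simp add: times_mps_def)
  qed
  show "f * g * h = f * (g * h)"
  proof (rule mps_eqI)
    fix m
    have "mps_coeff (f * g * h) m =
        (\<Sum>x\<in>mono_splits m. \<Sum>y\<in>mono_splits (fst x).
           mps_coeff f (fst y) * mps_coeff g (snd y) * mps_coeff h (snd x))"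
      by (simp add: times_mps_def case_prod_unfold sum_distrib_right)
    also have "\<dots> = (\<Sum>(x, y)\<in>(SIGMA x:mono_splits m. mono_splits (fst x)).
           mps_coeff f (fst y) * mps_coeff g (snd y) * mps_coeff h (snd x))"
      by (simp add: sum.Sigma)
    also have "\<dots> = (\<Sum>(x, y)\<in>(SIGMA x:mono_splits m. mono_splits (snd x)).
           mps_coeff f (fst x) * (mps_coeff g (fst y) * mps_coeff h (snd y)))"
      by (rule sum.reindex_bij_witness
            [of _ "\<lambda>((a, d), (b, c)). ((a + b, c), (a, b))"
                  "\<lambda>((d, c), (a, b)). ((a, b + c), (b, c))"])
         (auto simp: mono_splits_def ac_simps)
    also have "\<dots> = mps_coeff (f * (g * h)) m"
      by (simp add: times_mps_def case_prod_unfold sum_distrib_left sum.Sigma)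
    finally show "mps_coeff (f * g * h) m = mps_coeff (f * (g * h)) m" .
  qed
  show "1 * f = f"
  proof (rule mps_eqI)
    fix m
    have "(\<Sum>x\<in>mono_splits m. (if fst x = 0 then 1 else 0) * mps_coeff f (snd x))
        = (\<Sum>x\<in>{(0 :: 'a \<Rightarrow>\<^sub>0 nat, m)}. mps_coeff f (snd x))"
    proof (rule sum.mono_neutral_cong_right[OF finite_mono_splits])
      show "{(0, m)} \<subseteq> mono_splits m" by (simp add: mono_splits_def)
      have "fst x \<noteq> 0" if "x \<in> mono_splits m - {(0, m)}" for x
        using that by (cases x) (fastforce simp: mono_splits_def)
      then show "\<forall>x\<in>mono_splits m - {(0, m)}. (if fst x = 0 then 1 else 0) * mps_coeff f (snd x) = 0"
        by simp
    qed simp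
    then show "mps_coeff (1 * f) m = mps_coeff f m"
      by (simp add: times_mps_def one_mps_def case_prod_unfold)
  qed
  show "(f + g) * h = f * h + g * h"
    by (rule mps_eqI)
       (simp add: times_mps_def plus_mps_def case_prod_unfold ring_distribs sum.distrib)
  show "0 \<noteq> (1 :: ('a, 'b) mps)"
  proof
    assume "0 = (1 :: ('a, 'b) mps)"
    then have "mps_coeff (0 :: ('a, 'b) mps) 0 = mps_coeff 1 0" by simp
    then show False by (simp add: zero_mps_def one_mps_def)
  qed
qed (rule mps_eqI, simp add: add_ac plus_mps_def zero_mps_def uminus_mps_def minus_mps_def)+

end

definition mps_const :: "'a \<Rightarrow> ('v, 'a :: comm_ring_1) mps" where
  "mps_const c = Abs_mps (\<lambda>m. if m = 0 then c else 0)"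

definition mps_var :: "'v \<Rightarrow> ('v, 'a :: comm_ring_1) mps" where
  "mps_var v = Abs_mps (\<lambda>m. if m = Poly_Mapping.single v 1 then 1 else 0)"

text \<open>
  The sum of a locally finite family (every monomial occurs in only finitely many members),
  taken coefficientwise. On other families the value is irrelevant: a coefficient with infinitely
  many nonzero contributions is set to \<open>0\<close> by the convention for \<^const>\<open>sum\<close>.
\<close>

definition mps_sum :: "('i \<Rightarrow> ('v, 'a :: comm_ring_1) mps) \<Rightarrow> 'i set \<Rightarrow> ('v, 'a) mps" where
  "mps_sum F I = Abs_mps (\<lambda>m. \<Sum>i\<in>{i \<in> I. mps_coeff (F i) m \<noteq> 0}. mps_coeff (F i) m)"

text \<open>
  Only meaningful for series without constant term, for which the family below is locally finite.
\<close>

definition mps_exp :: "('v, 'a :: field_char_0) mps \<Rightarrow> ('v, 'a) mps" where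
  "mps_exp F = mps_sum (\<lambda>m. mps_const (1 / fact m) * F ^ m) UNIV"


section \<open>The hyperoctahedral group\<close>

definition signed_points :: "nat \<Rightarrow> int set" where
  "signed_points n = {i. i \<noteq> 0 \<and> \<bar>i\<bar> \<le> int n}"

text \<open>
  Signed permutations are extended by the identity to all of \<^typ>\<open>int\<close>.
\<close>

definition hyperoctahedral :: "nat \<Rightarrow> (int \<Rightarrow> int) monoid" where
  "hyperoctahedral n = \<lparr>carrier = {w. w permutes signed_points n \<and> (\<forall>i. w (- i) = - w i)},
          mult = (\<circ>), one = id\<rparr>"

lemma group_hyperoctahedral: "group (hyperoctahedral n)"
proof (rule groupI)
  fix x assume x: "x \<in> carrier (hyperoctahedral n)"
  have "Hilbert_Choice.inv x (- i) = - Hilbert_Choice.inv x i" for i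
    using x by (intro inv_f_eq) (auto simp: hyperoctahedral_def permutes_inj permutes_inverses)
  then show "\<exists>y\<in>carrier (hyperoctahedral n). y \<otimes>\<^bsub>hyperoctahedral n\<^esub> x = \<one>\<^bsub>hyperoctahedral n\<^esub>"
    using x by (intro bexI[of _ "Hilbert_Choice.inv x"])
      (auto simp: hyperoctahedral_def permutes_inv permutes_inv_o)
qed (auto simp: hyperoctahedral_def permutes_compose permutes_id comp_assoc)

definition chi :: "nat \<Rightarrow> (int \<Rightarrow> int) \<Rightarrow> int" where
  "chi n w = (\<Prod>i\<in>{1..int n}. sgn (w i))"

definition abs_perm :: "nat \<Rightarrow> (int \<Rightarrow> int) \<Rightarrow> (int \<Rightarrow> int)" where
  "abs_perm n w = (\<lambda>i. if i \<in> {1..int n} then \<bar>w i\<bar> else i)"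

definition chi' :: "nat \<Rightarrow> (int \<Rightarrow> int) \<Rightarrow> int" where
  "chi' n w = sign (abs_perm n w)"

definition roots' :: "nat \<Rightarrow> nat \<Rightarrow> (int \<Rightarrow> int) \<Rightarrow> int" where
  "roots' k n y = (\<Sum>x | x \<in> carrier (hyperoctahedral n) \<and> x [^]\<^bsub>hyperoctahedral n\<^esub> k = y. chi' n x)"

definition sroots' :: "nat \<Rightarrow> nat \<Rightarrow> (int \<Rightarrow> int) \<Rightarrow> int" where
  "sroots' k n y = (\<Sum>x | x \<in> carrier (hyperoctahedral n) \<and> x [^]\<^bsub>hyperoctahedral n\<^esub> k = y. chi n x * chi' n x)"

definition centralizer :: "nat \<Rightarrow> (int \<Rightarrow> int) \<Rightarrow> (int \<Rightarrow> int) set" where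
  "centralizer n w = {z \<in> carrier (hyperoctahedral n). z \<otimes>\<^bsub>hyperoctahedral n\<^esub> w = w \<otimes>\<^bsub>hyperoctahedral n\<^esub> z}"


section \<open>Cycles and conjugacy classes\<close>

text \<open>
  An ordinary cycle of \<open>w\<close> is identified with its set of entries (an orbit of \<open>w\<close>), and negating
  the entries of \<open>c\<close> gives \<open>uminus ` c\<close>. A signed cycle is the set \<open>{c, uminus ` c}\<close>.
\<close>

definition cycles :: "nat \<Rightarrow> (int \<Rightarrow> int) \<Rightarrow> int set set" where
  "cycles n w = orbit w ` signed_points n"

definition signed_cycles :: "nat \<Rightarrow> (int \<Rightarrow> int) \<Rightarrow> int \<Rightarrow> int set set set" where
  "signed_cycles n w \<theta> =
     {{c, uminus ` c} | c. c \<in> cycles n w \<and> (if \<theta> = 1 then c \<noteq> uminus ` c else c = uminus ` c)}"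

text \<open>
  In class \<open>1\<close> the union consists of two disjoint cycles of length \<open>l\<close>, and the length is \<open>l\<close>;
  in class \<open>-1\<close> it is a single cycle of length \<open>l\<close>, and the length is \<open>l / 2\<close>. In both cases this
  is half the number of entries.
\<close>

definition signed_cycle_length :: "int set set \<Rightarrow> nat" where
  "signed_cycle_length C = card (\<Union>C) div 2"

definition Z2 :: "int set" where
  "Z2 = {1, - 1}"

text \<open>
  A bipartition is the pair of multisets of parts of \<open>\<mu>\<^sup>+\<close> and \<open>\<mu>\<^sup>-\<close>.
\<close>

type_synonym bipartition = "nat multiset \<times> nat multiset"

definition bipartitions :: "nat \<Rightarrow> bipartition set" where
  "bipartitions n =
     {(p, q). 0 \<notin># p \<and> 0 \<notin># q \<and> sum_mset p + sum_mset q = n}"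

definition component :: "bipartition \<Rightarrow> int \<Rightarrow> nat multiset" where
  "component \<mu> \<theta> = (if \<theta> = 1 then fst \<mu> else snd \<mu>)"

definition parts_of :: "bipartition \<Rightarrow> nat \<Rightarrow> int \<Rightarrow> nat" where
  "parts_of \<mu> j \<theta> = count (component \<mu> \<theta>) j"

definition cycle_type :: "nat \<Rightarrow> (int \<Rightarrow> int) \<Rightarrow> bipartition" where
  "cycle_type n w =
     (image_mset signed_cycle_length (mset_set (signed_cycles n w 1)),
      image_mset signed_cycle_length (mset_set (signed_cycles n w (- 1))))"

definition class_rep :: "nat \<Rightarrow> bipartition \<Rightarrow> (int \<Rightarrow> int)" where
  "class_rep n \<mu> = (SOME w. w \<in> carrier (hyperoctahedral n) \<and> cycle_type n w = \<mu>)"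


section \<open>The generating functions\<close>

text \<open>
  The variables \<open>t\<^bsub>j,\<theta>\<^esub>\<close> are indexed by pairs in \<^typ>\<open>nat \<times> int\<close>, of which only those with
  \<open>j \<ge> 1\<close> and \<open>\<theta> \<in> Z2\<close> are used.
\<close>

type_synonym series = "(nat \<times> int, complex) mps"

abbreviation t_var :: "nat \<Rightarrow> int \<Rightarrow> series" where
  "t_var j \<theta> \<equiv> mps_var (j, \<theta>)"

text \<open>
  The product ranges over the parts that occur; all other exponents \<open>j * b\<^bsub>j,\<theta>\<^esub>\<close> are \<open>0\<close>.
\<close>

definition t_monom :: "bipartition \<Rightarrow> series" where
  "t_monom \<mu> = (\<Prod>\<theta>\<in>Z2. \<Prod>j\<in>set_mset (component \<mu> \<theta>). t_var j \<theta> ^ (j * parts_of \<mu> j \<theta>))"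

definition class_series :: "(nat \<Rightarrow> (int \<Rightarrow> int) \<Rightarrow> int) \<Rightarrow> series" where
  "class_series f =
     mps_sum (\<lambda>n. \<Sum>\<mu>\<in>bipartitions n.
        mps_const (of_int (f n (class_rep n \<mu>)) / of_nat (card (centralizer n (class_rep n \<mu>))))
        * t_monom \<mu>) UNIV"

definition roots_Z2 :: "nat \<Rightarrow> int \<Rightarrow> int" where
  "roots_Z2 h \<theta> = int (card {\<epsilon> \<in> Z2. \<epsilon> ^ h = \<theta>})"

definition sroots_Z2 :: "nat \<Rightarrow> int \<Rightarrow> int" where
  "sroots_Z2 h \<theta> = (\<Sum>\<epsilon> | \<epsilon> \<in> Z2 \<and> \<epsilon> ^ h = \<theta>. \<epsilon>)"

definition exponent_series :: "(nat \<Rightarrow> int \<Rightarrow> int) \<Rightarrow> nat \<Rightarrow> series" where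
  "exponent_series r k =
     mps_sum (\<lambda>(j, \<theta>). \<Sum>h | h dvd k \<and> coprime h j.
        mps_const (of_int (r h \<theta>) / (2 * of_nat j * of_nat k / of_nat h))
        * (- ((- t_var j \<theta>) ^ (j * (k div h))))) ({1..} \<times> Z2)"

lemma finite_bipartitions: "finite (bipartitions n)"
proof -
  have fin: "finite {p :: nat multiset. 0 \<notin># p \<and> sum_mset p \<le> n}"
  proof (rule finite_subset)
    show "{p :: nat multiset. 0 \<notin># p \<and> sum_mset p \<le> n}
            \<subseteq> mset ` {xs. set xs \<subseteq> {..n} \<and> length xs \<le> n}"
    proof
      fix p :: "nat multiset" assume p: "p \<in> {p. 0 \<notin># p \<and> sum_mset p \<le> n}"
      obtain xs where xs: "p = mset xs" by (metis ex_mset)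
      have "length xs \<le> sum_list xs" if "0 \<notin> set xs" for xs :: "nat list"
        using that by (induction xs) auto
      moreover have "x \<le> sum_list xs" if "x \<in> set xs" for x
        using that by (intro member_le_sum_list) auto
      ultimately show "p \<in> mset ` {xs. set xs \<subseteq> {..n} \<and> length xs \<le> n}"
        using p xs by (force simp: sum_mset_sum_list)
    qed
  qed (simp add: finite_lists_length_le)
  show ?thesis
    by (rule finite_subset[OF _ finite_cartesian_product[OF fin fin]])
       (auto simp: bipartitions_def)
qed

end

theory Submission
  imports Defs
begin

text \<open>
  By orbit counting, the part \<open>A\<^sub>n\<close> of degree \<open>n\<close> on the left is the average over \<open>x \<in> B\<^sub>n\<close> of a linear character of \<open>x\<close> times the cycle monomial of
  \<open>x\<^sup>k\<close>. That monomial is a product over the signed cycles of \<open>x\<close>: a cycle of length \<open>m\<close> and class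
  \<open>\<epsilon>\<close> contributes \<open>t\<^bsub>j,\<theta>\<^esub>\<^sup>m\<close> with \<open>j = m / gcd m k\<close> and \<open>\<theta> = \<epsilon>\<^bsup>k / gcd m k\<^esup>\<close>, and the character is
  multiplicative over cycles too. Splitting off the cycle through a chosen point gives
  \<open>2 n A\<^sub>n = \<Sum>\<^bsub>m \<le> n\<^esub> (T\<^bsub>m,1\<^esub> + T\<^bsub>m,-1\<^esub>) A\<^bsub>n - m\<^esub>\<close>, where \<open>T\<^bsub>m,\<epsilon>\<^esub>\<close> is the weight
  of one cycle. The homogeneous components of the exponential satisfy the same recursion, by the
  Euler derivation.
\<close>

section \<open>Formal power series\<close>

text \<open>The sign \<open>-(-t)^m\<close> in the exponent is \<open>(-1)^(m-1) t^m\<close>: a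
  signed cycle of length m is a product of m - 1 swaps, and of one further sign change exactly when
  its class is -1. Both \<open>chi'\<close> and \<open>chi * chi'\<close> take the value -1 on
  swaps; they differ only in the value s on sign changes, which is 1 or -1. So both identities are
  instances of one statement with parameter s, and the weights 1 and s, summed over the \<epsilon>
  with \<epsilon>^h = \<theta>, give the two root functions of Z2. The 2 in the denominators comes
  from |B_n| = 2 n |B_(n-1)|. Removing a cycle destroys the interval 1..n, so the recursion is
  proved for signed permutations of any finite symmetric set. It takes place in a ring of series and
  is kept free of division: the sum itself, not the average, is compared with 2^n n! E_n for an
  arbitrary solution E. Orbit counting also needs that bipartitions classify: each one occurs as a
  cycle type, and equal cycle types imply conjugacy. Total degree with all variables of weight one
  recovers n, because a part j enters the cycle monomial with exponent j.\<close>

lemma mps_coeff_zero [simp]: "mps_coeff 0 m = 0"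
  and mps_coeff_one: "mps_coeff 1 m = (if m = 0 then 1 else 0)"
  and mps_coeff_add [simp]: "mps_coeff (f + g) m = mps_coeff f m + mps_coeff g m"
  and mps_coeff_uminus [simp]: "mps_coeff (- f) m = - mps_coeff f m"
  and mps_coeff_mult: "mps_coeff (f * g) m = (\<Sum>(a, b)\<in>mono_splits m. mps_coeff f a * mps_coeff g b)"
  by (simp_all add: zero_mps_def one_mps_def plus_mps_def uminus_mps_def times_mps_def)

lemma mps_coeff_sum [simp]: "mps_coeff (sum F I) m = (\<Sum>i\<in>I. mps_coeff (F i) m)"
  by (induction I rule: infinite_finite_induct) simp_all

lemma mps_coeff_const: "mps_coeff (mps_const c) m = (if m = 0 then c else 0)"
  by (simp add: mps_const_def)

lemma mps_coeff_const_mult [simp]: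
  fixes f :: "('v, 'a :: comm_ring_1) mps"
  shows "mps_coeff (mps_const c * f) m = c * mps_coeff f m"
proof -
  let ?c = "mps_const c :: ('v, 'a) mps"
  have "(\<Sum>(a, b)\<in>mono_splits m. mps_coeff ?c a * mps_coeff f b)
      = (\<Sum>(a, b)\<in>{(0, m)}. mps_coeff ?c a * mps_coeff f b)"
    by (rule sum.mono_neutral_right[OF finite_mono_splits])
      (auto simp: mono_splits_def mps_coeff_const split: if_splits)
  then show ?thesis
    by (simp add: mps_coeff_mult mps_coeff_const)
qed

lemma mps_const_one [simp]: "mps_const 1 = 1"
  by (rule mps_eqI) (simp add: mps_const_def mps_coeff_one)

lemma mps_const_mult: "mps_const (a * b) = mps_const a * mps_const b"
  by (rule mps_eqI) (simp add: mps_coeff_const)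

lemma mps_const_add: "mps_const (a + b) = mps_const a + mps_const b"
  by (rule mps_eqI) (simp add: mps_const_def)

lemma mps_const_uminus: "mps_const (- a) = - mps_const a"
  by (rule mps_eqI) (simp add: mps_const_def)

lemma mps_const_of_nat: "mps_const (of_nat n) = of_nat n"
proof (induction n)
  case 0
  show ?case by (rule mps_eqI) (simp add: mps_const_def)
qed (simp add: mps_const_add)

lemma mps_const_of_int: "mps_const (of_int n) = of_int n"
  by (cases n) (simp_all add: mps_const_of_nat mps_const_uminus flip: of_nat_Suc)

lemma mps_coeff_of_nat_mult [simp]: "mps_coeff (of_nat n * f) m = of_nat n * mps_coeff f m"
  by (simp flip: mps_const_of_nat)

section \<open>Total degree and homogeneous components\<close>

definition mdeg :: "('v \<Rightarrow>\<^sub>0 nat) \<Rightarrow> nat" where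
  "mdeg m = (\<Sum>x\<in>Poly_Mapping.keys m. Poly_Mapping.lookup m x)"

lemma mdeg_superset:
  assumes "finite K" "Poly_Mapping.keys m \<subseteq> K"
  shows "mdeg m = (\<Sum>x\<in>K. Poly_Mapping.lookup m x)"
  unfolding mdeg_def using assms by (intro sum.mono_neutral_left) (auto simp: in_keys_iff)

lemma mdeg_add [simp]: "mdeg (a + b) = mdeg a + mdeg b"
proof -
  let ?K = "Poly_Mapping.keys a \<union> Poly_Mapping.keys b"
  have "mdeg (a + b) = (\<Sum>x\<in>?K. Poly_Mapping.lookup (a + b) x)"
    by (rule mdeg_superset) (simp_all add: Poly_Mapping.keys_add)
  also have "\<dots> = mdeg a + mdeg b"
    by (simp add: lookup_add sum.distrib flip: mdeg_superset)
  finally show ?thesis .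
qed

lemma mdeg_single [simp]: "mdeg (Poly_Mapping.single x l) = l"
  by (simp add: mdeg_def)

lemma mdeg_zero [simp]: "mdeg 0 = 0"
  by (simp add: mdeg_def)

lemma mdeg_eq_0_iff: "mdeg m = 0 \<longleftrightarrow> m = 0"
  by (auto simp: mdeg_def in_keys_iff intro!: poly_mapping_eqI)

definition hcomp :: "nat \<Rightarrow> ('v, 'a :: comm_ring_1) mps \<Rightarrow> ('v, 'a) mps" where
  "hcomp n f = Abs_mps (\<lambda>m. if mdeg m = n then mps_coeff f m else 0)"

lemma mps_coeff_hcomp: "mps_coeff (hcomp n f) m = (if mdeg m = n then mps_coeff f m else 0)"
  by (simp add: hcomp_def)

lemma hcomp_mult: "hcomp n (f * g) = (\<Sum>i\<le>n. hcomp i f * hcomp (n - i) g)"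
proof (rule mps_eqI)
  fix m
  have "mps_coeff (\<Sum>i\<le>n. hcomp i f * hcomp (n - i) g) m
      = (\<Sum>(a, b)\<in>mono_splits m. \<Sum>i\<le>n. mps_coeff (hcomp i f) a * mps_coeff (hcomp (n - i) g) b)"
    by (simp add: mps_coeff_mult case_prod_unfold sum.swap[of _ "{..n}"])
  also have "\<dots> = (\<Sum>(a, b)\<in>mono_splits m. if mdeg m = n then mps_coeff f a * mps_coeff g b else 0)"
  proof (rule sum.cong[OF refl], clarify)
    fix a b assume "(a, b) \<in> mono_splits m"
    then have m: "mdeg m = mdeg a + mdeg b" by (auto simp: mono_splits_def)
    have "(\<Sum>i\<le>n. mps_coeff (hcomp i f) a * mps_coeff (hcomp (n - i) g) b)
        = (\<Sum>i\<le>n. if i = mdeg a then mps_coeff f a * mps_coeff (hcomp (n - i) g) b else 0)"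
      by (rule sum.cong) (auto simp: mps_coeff_hcomp)
    also have "\<dots> = (if mdeg m = n then mps_coeff f a * mps_coeff g b else 0)"
      using m by (auto simp: mps_coeff_hcomp)
    finally show "(\<Sum>i\<le>n. mps_coeff (hcomp i f) a * mps_coeff (hcomp (n - i) g) b)
      = (if mdeg m = n then mps_coeff f a * mps_coeff g b else 0)" .
  qed
  also have "\<dots> = mps_coeff (hcomp n (f * g)) m"
    by (simp add: mps_coeff_hcomp mps_coeff_mult case_prod_unfold)
  finally show "mps_coeff (hcomp n (f * g)) m = mps_coeff (\<Sum>i\<le>n. hcomp i f * hcomp (n - i) g) m" ..
qed

section \<open>The Euler derivation and the exponential\<close>

definition mps_euler :: "('v, 'a :: comm_ring_1) mps \<Rightarrow> ('v, 'a) mps" where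
  "mps_euler f = Abs_mps (\<lambda>m. of_nat (mdeg m) * mps_coeff f m)"

lemma mps_coeff_euler [simp]: "mps_coeff (mps_euler f) m = of_nat (mdeg m) * mps_coeff f m"
  by (simp add: mps_euler_def)

lemma mps_euler_mult: "mps_euler (f * g) = mps_euler f * g + f * mps_euler g"
proof (rule mps_eqI)
  fix m
  have "mps_coeff (mps_euler (f * g)) m
      = (\<Sum>(a, b)\<in>mono_splits m. of_nat (mdeg m) * (mps_coeff f a * mps_coeff g b))"
    by (simp add: mps_coeff_mult sum_distrib_left case_prod_unfold)
  also have "\<dots> = (\<Sum>(a, b)\<in>mono_splits m. of_nat (mdeg a) * mps_coeff f a * mps_coeff g b
      + mps_coeff f a * (of_nat (mdeg b) * mps_coeff g b))"
    by (rule sum.cong) (auto simp: mono_splits_def algebra_simps)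
  also have "\<dots> = mps_coeff (mps_euler f * g + f * mps_euler g) m"
    by (simp add: mps_coeff_mult sum.distrib case_prod_unfold)
  finally show "mps_coeff (mps_euler (f * g)) m = mps_coeff (mps_euler f * g + f * mps_euler g) m" .
qed

lemma mps_euler_power: "mps_euler (f ^ Suc n) = of_nat (Suc n) * (mps_euler f * f ^ n)"
proof (induction n)
  case (Suc n)
  have "mps_euler (f ^ Suc (Suc n)) = mps_euler f * f ^ Suc n + f * mps_euler (f ^ Suc n)"
    by (metis mps_euler_mult power_Suc)
  then show ?case unfolding Suc.IH by (simp add: algebra_simps)
qed simp

lemma hcomp_euler: "hcomp n (mps_euler f) = of_nat n * hcomp n f"
  by (rule mps_eqI) (simp add: mps_coeff_hcomp)

text \<open>Without a constant term every factor raises the degree by at least one. Hence only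
  finitely many powers reach a given monomial, which makes \<open>mps_exp\<close> a finite sum in
  each coefficient.\<close>

lemma mps_coeff_power_eq_0:
  assumes "mps_coeff F 0 = 0" "mdeg m < n"
  shows "mps_coeff (F ^ n) m = 0"
  using assms(2)
proof (induction n arbitrary: m)
  case (Suc n)
  have "mps_coeff F a * mps_coeff (F ^ n) b = 0" if "a + b = m" for a b
  proof (cases "a = 0")
    case False
    then have "mdeg b < n" using Suc.prems that mdeg_eq_0_iff[of a] by auto
    then show ?thesis using Suc.IH by simp
  qed (simp add: assms)
  then show ?case by (auto simp: mps_coeff_mult mono_splits_def intro!: sum.neutral)
qed simp

lemma mps_coeff_exp:
  fixes F :: "('v, 'a :: field_char_0) mps"
  assumes "mps_coeff F 0 = 0" "mdeg m < N"
  shows "mps_coeff (mps_exp F) m = mps_coeff (\<Sum>n<N. mps_const (1 / fact n) * F ^ n) m"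
proof -
  have "n < N" if "mps_coeff (F ^ n) m \<noteq> 0" for n
    using that mps_coeff_power_eq_0[OF assms(1), of m n] assms(2) by linarith
  then show ?thesis
    unfolding mps_exp_def mps_sum_def mps_coeff_Abs mps_coeff_sum
    by (intro sum.mono_neutral_left) auto
qed

lemma mps_euler_exp:
  fixes F :: "('v, 'a :: field_char_0) mps"
  assumes "mps_coeff F 0 = 0"
  shows "mps_euler (mps_exp F) = mps_euler F * mps_exp F"
proof (rule mps_eqI)
  fix m :: "'v \<Rightarrow>\<^sub>0 nat"
  define N where "N = Suc (mdeg m)"
  \<comment> \<open>One summand more than \<open>N\<close>: applying \<open>mps_euler\<close> kills
    the term n = 0 and turns \<open>F ^ Suc n\<close> into a multiple of \<open>F ^ n\<close>, which
    leaves exactly \<open>N\<close> summands.\<close>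
  have "mps_coeff (mps_euler (mps_exp F)) m = of_nat (mdeg m) * mps_coeff (\<Sum>n<Suc N. mps_const (1 / fact n) * F ^ n) m"
    using mps_coeff_exp[OF assms, of m "Suc N"] by (simp add: N_def)
  also have "\<dots> = (\<Sum>n<Suc N. 1 / fact n * mps_coeff (mps_euler (F ^ n)) m)"
    by (simp only: mps_coeff_sum mps_coeff_const_mult mps_coeff_euler sum_distrib_left mult.left_commute)
  also have "\<dots> = (\<Sum>n<N. 1 / fact (Suc n) * mps_coeff (mps_euler (F ^ Suc n)) m)"
    by (subst sum.lessThan_Suc_shift) (simp add: mps_coeff_one mdeg_eq_0_iff)
  also have "\<dots> = (\<Sum>n<N. 1 / fact n * mps_coeff (mps_euler F * F ^ n) m)"
    unfolding mps_euler_power by (simp del: power_Suc of_nat_Suc)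
  also have "\<dots> = mps_coeff (mps_euler F * (\<Sum>n<N. mps_const (1 / fact n) * F ^ n)) m"
    by (simp only: sum_distrib_left mps_coeff_sum mult.left_commute[of _ "mps_const _"] mps_coeff_const_mult)
  also have "\<dots> = mps_coeff (mps_euler F * mps_exp F) m"
    unfolding mps_coeff_mult
  proof (rule sum.cong[OF refl], clarify)
    fix a b assume "(a, b) \<in> mono_splits m"
    then have "mdeg b < N" by (auto simp: mono_splits_def N_def)
    from mps_coeff_exp[OF assms this]
    show "mps_coeff (mps_euler F) a * mps_coeff (\<Sum>n<N. mps_const (1 / fact n) * F ^ n) b
      = mps_coeff (mps_euler F) a * mps_coeff (mps_exp F) b" by simp
  qed
  finally show "mps_coeff (mps_euler (mps_exp F)) m = mps_coeff (mps_euler F * mps_exp F) m" .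
qed

lemma hcomp_exp_0:
  assumes "mps_coeff F 0 = 0"
  shows "hcomp 0 (mps_exp F) = 1"
  by (rule mps_eqI)
    (use mps_coeff_exp[OF assms, of 0 1] in \<open>auto simp: mps_coeff_hcomp mps_coeff_one mdeg_eq_0_iff\<close>)

text \<open>This is the degree n part of \<open>mps_euler_exp\<close>; the term i = 0 carries the
  factor 0. Together with \<open>hcomp_exp_0\<close> it determines every component of the
  exponential.\<close>

lemma hcomp_exp_rec:
  assumes "mps_coeff F 0 = 0"
  shows "of_nat n * hcomp n (mps_exp F) = (\<Sum>i=1..n. of_nat i * hcomp i F * hcomp (n - i) (mps_exp F))"
proof -
  have "of_nat n * hcomp n (mps_exp F) = (\<Sum>i\<le>n. of_nat i * hcomp i F * hcomp (n - i) (mps_exp F))"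
    by (simp add: mps_euler_exp[OF assms] hcomp_mult hcomp_euler flip: hcomp_euler[of n "mps_exp F"])
  also have "\<dots> = (\<Sum>i=1..n. of_nat i * hcomp i F * hcomp (n - i) (mps_exp F))"
    by (rule sum.mono_neutral_right) (auto simp: not_less_eq_eq)
  finally show ?thesis .
qed

section \<open>Signed permutations and the types of their cycles\<close>

text \<open>This class of sets is closed under removing signed cycles, unlike the sets
  \<open>signed_points n\<close>, so inductions can run over it.\<close>

definition sym_set :: "int set \<Rightarrow> bool" where
  "sym_set S \<longleftrightarrow> finite S \<and> 0 \<notin> S \<and> (\<forall>i\<in>S. - i \<in> S)"

definition pos_part :: "int set \<Rightarrow> int set" where
  "pos_part S = {i \<in> S. 0 < i}"

definition odd_perms :: "int set \<Rightarrow> (int \<Rightarrow> int) set" where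
  "odd_perms S = {w. w permutes S \<and> (\<forall>i. w (- i) = - w i)}"

lemma sym_set_minus_iff: "sym_set S \<Longrightarrow> - i \<in> S \<longleftrightarrow> i \<in> S"
  by (metis sym_set_def minus_minus)

lemma sym_set_Diff: "sym_set S \<Longrightarrow> sym_set C \<Longrightarrow> sym_set (S - C)"
  by (auto simp: sym_set_def sym_set_minus_iff)

lemma sym_set_signed_points: "sym_set (signed_points n)"
proof -
  have "finite (signed_points n)"
    by (rule finite_subset[of _ "{- int n..int n}"]) (auto simp: signed_points_def)
  then show ?thesis by (auto simp: sym_set_def signed_points_def)
qed

lemma pos_part_signed_points: "pos_part (signed_points n) = {1..int n}"
  by (auto simp: pos_part_def signed_points_def)

lemma card_sym_set:
  assumes "sym_set S"
  shows "card S = 2 * card (pos_part S)"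
proof -
  have S: "S = pos_part S \<union> uminus ` pos_part S"
  proof (rule equalityI; rule subsetI)
    fix i assume "i \<in> S"
    then have "i \<in> pos_part S \<or> - i \<in> pos_part S"
      using assms by (cases "0 < i") (auto simp: pos_part_def sym_set_def intro: le_neq_trans)
    then show "i \<in> pos_part S \<union> uminus ` pos_part S" by force
  qed (use assms in \<open>auto simp: pos_part_def sym_set_def\<close>)
  have "card S = card (pos_part S) + card (uminus ` pos_part S)"
    by (subst S, rule card_Un_disjoint) (use assms in \<open>auto simp: pos_part_def sym_set_def\<close>)
  also have "card (uminus ` pos_part S) = card (pos_part S)"
    by (rule card_image) simp
  finally show ?thesis by simp
qed

lemma carrier_hyperoctahedral: "carrier (hyperoctahedral n) = odd_perms (signed_points n)"
  by (simp add: hyperoctahedral_def odd_perms_def)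

lemma odd_permsD:
  assumes "w \<in> odd_perms S"
  shows "w permutes S" "w (- i) = - w i" "inj w" "w 0 = 0"
proof -
  show "w permutes S" "w (- i) = - w i" for i using assms by (auto simp: odd_perms_def)
  then show "inj w" "w 0 = 0" using permutes_inj by (blast, metis minus_zero neg_equal_zero)
qed

lemma odd_perms_in_iff: "w \<in> odd_perms S \<Longrightarrow> w x \<in> S \<longleftrightarrow> x \<in> S"
  by (simp add: odd_permsD(1) permutes_in_image)

lemma odd_perms_id [simp]: "id \<in> odd_perms S"
  by (simp add: odd_perms_def permutes_id)

lemma odd_perms_comp: "w \<in> odd_perms S \<Longrightarrow> w' \<in> odd_perms S \<Longrightarrow> w \<circ> w' \<in> odd_perms S"
  by (auto simp: odd_perms_def intro: permutes_compose)

lemma odd_perms_inv: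
  assumes "w \<in> odd_perms S"
  shows "Hilbert_Choice.inv w \<in> odd_perms S"
proof -
  have w: "w permutes S" "\<And>i. w (- i) = - w i" using assms by (auto simp: odd_perms_def)
  then have "Hilbert_Choice.inv w (- i) = - Hilbert_Choice.inv w i" for i
    by (metis permutes_inverses)
  with w show ?thesis by (simp add: odd_perms_def permutes_inv)
qed

lemma odd_perms_funpow: "w \<in> odd_perms S \<Longrightarrow> w ^^ k \<in> odd_perms S"
  by (induction k) (auto simp: odd_perms_comp)

lemma odd_perms_mono: "S \<subseteq> U \<Longrightarrow> odd_perms S \<subseteq> odd_perms U"
  by (auto simp: odd_perms_def intro: permutes_subset)

lemma finite_odd_perms: "finite S \<Longrightarrow> finite (odd_perms S)"
  by (rule finite_subset[OF _ finite_permutations]) (auto simp: odd_perms_def)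

lemma odd_perms_abs_eq_iff:
  assumes "w \<in> odd_perms S"
  shows "\<bar>w x\<bar> = \<bar>w y\<bar> \<longleftrightarrow> \<bar>x\<bar> = \<bar>y\<bar>"
proof -
  have "w x = w y \<longleftrightarrow> x = y" "w x = - w y \<longleftrightarrow> x = - y"
    using inj_eq[OF odd_permsD(3)[OF assms]] odd_permsD(2)[OF assms] by metis+
  then show ?thesis by (simp add: abs_eq_iff)
qed

lemma Z2_iff: "e \<in> Z2 \<longleftrightarrow> e = 1 \<or> e = - 1"
  by (simp add: Z2_def)

lemma Z2_power: "e \<in> Z2 \<Longrightarrow> e ^ n \<in> Z2"
  by (auto simp: Z2_iff) (metis minus_one_power_iff)

lemma odd_perms_scale: "w \<in> odd_perms S \<Longrightarrow> e \<in> Z2 \<Longrightarrow> w (e * x) = e * w x"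
  by (auto simp: Z2_iff odd_permsD)

lemma abs_Z2_mult: "e \<in> Z2 \<Longrightarrow> \<bar>e * x\<bar> = \<bar>x\<bar>"
  by (auto simp: Z2_iff)

text \<open>
  The signed cycle of \<open>w\<close> through \<open>x\<close> has length \<open>m\<close> and class \<open>\<epsilon>\<close> for the least \<open>m > 0\<close> with
  \<open>w\<^sup>m x = \<epsilon> x\<close>, \<open>\<epsilon> = \<plusminus>1\<close>.
\<close>

definition clen :: "(int \<Rightarrow> int) \<Rightarrow> int \<Rightarrow> nat" where
  "clen w x = (LEAST m. 0 < m \<and> \<bar>(w ^^ m) x\<bar> = \<bar>x\<bar>)"

definition csgn :: "(int \<Rightarrow> int) \<Rightarrow> int \<Rightarrow> int" where
  "csgn w x = (if (w ^^ clen w x) x = x then 1 else - 1)"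

definition ctype :: "(int \<Rightarrow> int) \<Rightarrow> int \<Rightarrow> nat \<times> int" where
  "ctype w x = (clen w x, csgn w x)"

lemma csgn_Z2: "csgn w x \<in> Z2"
  by (simp add: csgn_def Z2_iff)

lemma ctype_cong: "(\<And>i. (w ^^ i) x = (w' ^^ i) x) \<Longrightarrow> ctype w x = ctype w' x"
  by (simp add: ctype_def clen_def csgn_def)

lemma ctype_eqI:
  assumes "0 < m" "(w ^^ m) x = e * x" "e \<in> Z2" "x \<noteq> 0"
    and "\<And>i. 0 < i \<Longrightarrow> i < m \<Longrightarrow> \<bar>(w ^^ i) x\<bar> \<noteq> \<bar>x\<bar>"
  shows "ctype w x = (m, e)"
proof -
  have "clen w x = m"
    unfolding clen_def
  proof (rule Least_equality)
    fix i assume "0 < i \<and> \<bar>(w ^^ i) x\<bar> = \<bar>x\<bar>"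
    then show "m \<le> i" using assms(5) by (meson not_less)
  qed (use assms in \<open>simp add: abs_Z2_mult\<close>)
  then show ?thesis
    using assms by (auto simp: ctype_def csgn_def Z2_iff)
qed

context
  fixes S w x
  assumes S: "sym_set S" and w: "w \<in> odd_perms S" and x: "x \<in> S"
begin

lemma nonzero_of_sym_set: "x \<noteq> 0"
  using S x by (auto simp: sym_set_def)

lemma clen_props:
  shows clen_pos: "0 < clen w x"
    and abs_funpow_clen: "\<bar>(w ^^ clen w x) x\<bar> = \<bar>x\<bar>"
    and abs_funpow_less_clen: "0 < i \<Longrightarrow> i < clen w x \<Longrightarrow> \<bar>(w ^^ i) x\<bar> \<noteq> \<bar>x\<bar>"
proof -
  have "x \<in> orbit w x"
    by (rule permutation_self_in_orbit) (use S odd_permsD(1)[OF w] in \<open>auto simp: permutation_permutes sym_set_def\<close>)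
  then have ex: "\<exists>m. 0 < m \<and> \<bar>(w ^^ m) x\<bar> = \<bar>x\<bar>"
    by (auto simp: orbit_altdef)
  from LeastI_ex[OF this] show "0 < clen w x" "\<bar>(w ^^ clen w x) x\<bar> = \<bar>x\<bar>"
    by (auto simp: clen_def)
  show "0 < i \<Longrightarrow> i < clen w x \<Longrightarrow> \<bar>(w ^^ i) x\<bar> \<noteq> \<bar>x\<bar>"
    using not_less_Least unfolding clen_def by blast
qed

lemma funpow_clen: "(w ^^ clen w x) x = csgn w x * x"
  using abs_funpow_clen by (auto simp: csgn_def abs_eq_iff)

lemma funpow_clen_mult: "(w ^^ (clen w x * q)) x = csgn w x ^ q * x"
proof (induction q)
  case (Suc q)
  have "(w ^^ (clen w x * Suc q)) x = (w ^^ (clen w x * q)) ((w ^^ clen w x) x)"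
    by (metis add.commute comp_apply funpow_add mult_Suc_right)
  also have "\<dots> = csgn w x * (w ^^ (clen w x * q)) x"
    by (simp add: funpow_clen odd_perms_scale[OF odd_perms_funpow[OF w] csgn_Z2])
  finally show ?case by (simp add: Suc)
qed simp

lemma abs_funpow_eq_iff: "\<bar>(w ^^ i) x\<bar> = \<bar>x\<bar> \<longleftrightarrow> clen w x dvd i"
proof
  let ?m = "clen w x"
  have "(w ^^ i) x = (w ^^ (i mod ?m)) ((w ^^ (?m * (i div ?m))) x)"
    by (metis comp_apply funpow_add mod_mult_div_eq)
  then have *: "\<bar>(w ^^ i) x\<bar> = \<bar>(w ^^ (i mod ?m)) x\<bar>"
    by (simp add: funpow_clen_mult odd_perms_scale[OF odd_perms_funpow[OF w]] csgn_Z2 Z2_power abs_Z2_mult)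
  assume "\<bar>(w ^^ i) x\<bar> = \<bar>x\<bar>"
  with * have "\<not> 0 < i mod ?m"
    using abs_funpow_less_clen[of "i mod ?m"] clen_pos by auto
  then show "?m dvd i" by auto
next
  assume "clen w x dvd i"
  then show "\<bar>(w ^^ i) x\<bar> = \<bar>x\<bar>"
    by (auto simp: funpow_clen_mult csgn_Z2 Z2_power abs_Z2_mult)
qed

lemma funpow_eq_scale_iff:
  assumes "d \<in> Z2"
  shows "(w ^^ i) x = d * x \<longleftrightarrow> clen w x dvd i \<and> d = csgn w x ^ (i div clen w x)"
proof -
  have "\<bar>(w ^^ i) x\<bar> = \<bar>x\<bar>" if "(w ^^ i) x = d * x"
    using that assms by (simp add: abs_Z2_mult)
  moreover have "(w ^^ i) x = csgn w x ^ (i div clen w x) * x" if "clen w x dvd i"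
    using funpow_clen_mult[of "i div clen w x"] that by simp
  ultimately show ?thesis
    using abs_funpow_eq_iff[of i] nonzero_of_sym_set by auto
qed

lemma ctype_step: "ctype w (w x) = ctype w x"
proof -
  have "(w ^^ i) (w x) = w ((w ^^ i) x)" for i by (simp add: funpow_swap1)
  then have "ctype w (w x) = (clen w x, csgn w x)"
    by (intro ctype_eqI)
      (use nonzero_of_sym_set inj_eq[OF odd_permsD(3)[OF w], of x 0] odd_permsD(4)[OF w] in
        \<open>auto simp: clen_pos funpow_clen odd_perms_scale[OF w] csgn_Z2 abs_funpow_less_clen odd_perms_abs_eq_iff[OF w]\<close>)
  then show ?thesis by (simp add: ctype_def)
qed

lemma ctype_uminus: "ctype w (- x) = ctype w x"
proof -
  have "(w ^^ i) (- x) = - (w ^^ i) x" for i by (rule odd_permsD(2)[OF odd_perms_funpow[OF w]])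
  then have "ctype w (- x) = (clen w x, csgn w x)"
    by (intro ctype_eqI) (use nonzero_of_sym_set in \<open>auto simp: clen_pos funpow_clen csgn_Z2 abs_funpow_less_clen\<close>)
  then show ?thesis by (simp add: ctype_def)
qed

text \<open>Write the length as a g and k = b g with a, b coprime. The i-th iterate of
  \<open>w ^^ k\<close> returns to \<plusminus>x iff a g divides b g i, that is iff a divides i; and
  since k a = b * \<open>clen w x\<close>, the sign at i = a is the b-th power of the class.\<close>

lemma ctype_power:
  assumes "0 < k"
  shows "ctype (w ^^ k) x = (clen w x div gcd (clen w x) k, csgn w x ^ (k div gcd (clen w x) k))"
proof -
  define g where "g = gcd (clen w x) k"
  obtain a b where ab: "clen w x = a * g" "k = b * g" "coprime a b"
    unfolding g_def using gcd_coprime_exists[of "clen w x" k] assms by auto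
  have g: "0 < g" "0 < a" using clen_pos assms ab by auto
  have "ctype (w ^^ k) x = (a, csgn w x ^ b)"
  proof (rule ctype_eqI)
    have "k * a = clen w x * b" by (simp add: ab)
    then show "((w ^^ k) ^^ a) x = csgn w x ^ b * x"
      by (simp only: funpow_mult funpow_clen_mult)
    show "0 < a" "csgn w x ^ b \<in> Z2" "x \<noteq> 0"
      by (simp_all add: g csgn_Z2 Z2_power nonzero_of_sym_set)
    fix i assume i: "0 < i" "i < a"
    have "\<not> a * g dvd b * g * i"
    proof
      assume "a * g dvd b * g * i"
      then have "a dvd b * i" using g by (simp add: mult.assoc mult.commute[of g] flip: mult.assoc)
      then have "a dvd i" using ab(3) by (simp add: coprime_dvd_mult_right_iff)
      then show False using i by (simp add: nat_dvd_not_less)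
    qed
    then have "\<not> clen w x dvd k * i" by (simp only: ab not_False_eq_True)
    then show "\<bar>((w ^^ k) ^^ i) x\<bar> \<noteq> \<bar>x\<bar>" by (simp only: funpow_mult abs_funpow_eq_iff not_False_eq_True)
  qed
  moreover have "a = clen w x div g" "b = k div g" using g by (simp_all add: ab)
  ultimately show ?thesis by (simp add: g_def)
qed

end

section \<open>Sums over signed permutations\<close>

definition abs_closure :: "int list \<Rightarrow> int set" where
  "abs_closure xs = {z. \<bar>z\<bar> \<in> abs ` set xs}"

text \<open>A partly revealed cycle: the image of the last entry is left open, and the recursion
  branches on it.\<close>

definition chain_of :: "(int \<Rightarrow> int) \<Rightarrow> int list \<Rightarrow> bool" where
  "chain_of w xs \<longleftrightarrow> (\<forall>i. Suc i < length xs \<longrightarrow> w (xs ! i) = xs ! Suc i)"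

lemma abs_closure_Nil [simp]: "abs_closure [] = {}"
  by (simp add: abs_closure_def)

lemma abs_closure_Cons: "abs_closure (x # xs) = {x, - x} \<union> abs_closure xs"
  by (auto simp: abs_closure_def abs_eq_iff)

lemma abs_closure_conv: "z \<in> abs_closure xs \<longleftrightarrow> (\<exists>x\<in>set xs. z = x \<or> z = - x)"
  by (auto simp: abs_closure_def abs_eq_iff)

lemma set_subset_abs_closure: "set xs \<subseteq> abs_closure xs"
  by (auto simp: abs_closure_conv)

lemma abs_closure_subset: "sym_set S \<Longrightarrow> set xs \<subseteq> S \<Longrightarrow> abs_closure xs \<subseteq> S"
  by (force simp: abs_closure_conv sym_set_def)

lemma sym_set_abs_closure:
  assumes "0 \<notin> set xs"
  shows "sym_set (abs_closure xs)"
proof -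
  have "abs_closure xs = set xs \<union> uminus ` set xs" by (auto simp: abs_closure_conv)
  then show ?thesis using assms by (auto simp: sym_set_def)
qed

lemma pos_part_abs_closure: "0 \<notin> set xs \<Longrightarrow> pos_part (abs_closure xs) = abs ` set xs"
  by (auto simp: pos_part_def abs_closure_def image_iff)

lemma card_pos_part_abs_closure:
  assumes "0 \<notin> set xs" "distinct (map abs xs)"
  shows "card (pos_part (abs_closure xs)) = length xs"
  using assms by (metis distinct_card length_map list.set_map pos_part_abs_closure)

lemma pos_part_Diff: "pos_part (S - C) = pos_part S - pos_part C"
  by (auto simp: pos_part_def)

lemma pos_part_mono: "C \<subseteq> S \<Longrightarrow> pos_part C \<subseteq> pos_part S"
  by (auto simp: pos_part_def)

lemma finite_pos_part: "sym_set S \<Longrightarrow> finite (pos_part S)"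
  by (simp add: sym_set_def pos_part_def)

lemma chain_of_funpow:
  assumes "chain_of w xs" "i < length xs"
  shows "(w ^^ i) (hd xs) = xs ! i"
  using assms(2)
proof (induction i)
  case 0
  then show ?case by (simp add: hd_conv_nth)
next
  case (Suc i)
  then show ?case using assms(1) by (simp add: chain_of_def)
qed

text \<open>Distinct absolute values rule out a return to \<open>\<plusminus>hd xs\<close> before
  the chain closes, which settles the type of \<open>hd xs\<close>; stepping along the cycle and
  negating do not change it.\<close>

lemma ctype_chain_of:
  assumes S: "sym_set S" and w: "w \<in> odd_perms S" and xs: "set xs \<subseteq> S" "xs \<noteq> []" "distinct (map abs xs)"
    and chain: "chain_of w xs" and last: "w (last xs) = e * hd xs" and e: "e \<in> Z2"
    and z: "z \<in> abs_closure xs"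
  shows "ctype w z = (length xs, e)"
proof -
  have hd: "hd xs \<in> S" using xs by auto
  then have nz: "hd xs \<noteq> 0" using S by (auto simp: sym_set_def)
  have "ctype w (hd xs) = (length xs, e)"
  proof (rule ctype_eqI)
    show "0 < length xs" using xs by simp
    obtain l where l: "length xs = Suc l" using xs by (cases xs) auto
    have "(w ^^ l) (hd xs) = last xs"
      using chain_of_funpow[OF chain, of l] l xs by (simp add: last_conv_nth)
    then show "(w ^^ length xs) (hd xs) = e * hd xs" by (simp add: l last)
    fix i assume i: "0 < i" "i < length xs"
    then have "map abs xs ! i \<noteq> map abs xs ! 0"
      using xs by (subst nth_eq_iff_index_eq) auto
    then show "\<bar>(w ^^ i) (hd xs)\<bar> \<noteq> \<bar>hd xs\<bar>"
      using i xs chain_of_funpow[OF chain i(2)] by (simp add: hd_conv_nth)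
  qed (use nz e in auto)
  moreover have "ctype w (xs ! i) = ctype w (hd xs)" if "i < length xs" for i
    using that
  proof (induction i)
    case (Suc i)
    then have "xs ! i \<in> S" "w (xs ! i) = xs ! Suc i"
      using xs(1) chain by (auto simp: chain_of_def)
    with Suc show ?case using ctype_step[OF S w, of "xs ! i"] by simp
  qed (use xs in \<open>simp add: hd_conv_nth\<close>)
  ultimately have "ctype w x = (length xs, e)" if "x \<in> set xs" for x
    using that by (auto simp: in_set_conv_nth)
  then show ?thesis
    using z xs ctype_uminus[OF S w] by (auto simp: abs_closure_conv)
qed

text \<open>\<open>w\<close> keeps \<open>S - C\<close> invariant and \<open>c\<close> is the
  identity there, so iterates starting in \<open>S - C\<close> never notice
  \<open>c\<close>.\<close>

lemma ctype_comp:
  assumes "c \<in> odd_perms C" "w \<in> odd_perms (S - C)" "x \<in> S - C"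
  shows "ctype (c \<circ> w) x = ctype w x"
proof (rule ctype_cong)
  fix i
  show "((c \<circ> w) ^^ i) x = (w ^^ i) x"
  proof (induction i)
    case (Suc i)
    have "w ((w ^^ i) x) \<in> S - C"
      using odd_perms_in_iff[OF odd_perms_funpow[OF assms(2), of "Suc i"]] assms(3) by simp
    then show ?case using Suc permutes_not_in[OF odd_permsD(1)[OF assms(1)]] by simp
  qed simp
qed

lemma chain_of_comp:
  assumes S: "sym_set S" and xs: "xs \<noteq> []" "set xs \<subseteq> S"
    and c: "c \<in> odd_perms (abs_closure xs)" "chain_of c xs" "c (last xs) = e * hd xs"
    and w: "w \<in> odd_perms (S - abs_closure xs)"
  shows "c \<circ> w \<in> odd_perms S" "chain_of (c \<circ> w) xs" "(c \<circ> w) (last xs) = e * hd xs"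
proof -
  have fix_xs: "w x = x" if "x \<in> set xs" for x
    using that permutes_not_in[OF odd_permsD(1)[OF w]] set_subset_abs_closure by blast
  have "odd_perms (abs_closure xs) \<subseteq> odd_perms S" "odd_perms (S - abs_closure xs) \<subseteq> odd_perms S"
    using abs_closure_subset[OF S xs(2)] by (auto intro!: odd_perms_mono)
  then show "c \<circ> w \<in> odd_perms S" using c(1) w by (intro odd_perms_comp) auto
  show "chain_of (c \<circ> w) xs" using c(2) fix_xs by (simp add: chain_of_def)
  show "(c \<circ> w) (last xs) = e * hd xs" using c(3) fix_xs xs(1) by simp
qed

text \<open>The points may have different signs, so this covers the reflections in e_i - e_j and in
  e_i + e_j alike.\<close>

definition swap_pair :: "int \<Rightarrow> int \<Rightarrow> int \<Rightarrow> int" where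
  "swap_pair x y = transpose x y \<circ> transpose (- x) (- y)"

lemma swap_pair_odd_perms:
  assumes "x \<noteq> 0" "y \<noteq> 0" "\<bar>x\<bar> \<noteq> \<bar>y\<bar>" "{x, - x, y, - y} \<subseteq> S"
  shows "swap_pair x y \<in> odd_perms S"
proof -
  have "swap_pair x y permutes S"
    unfolding swap_pair_def using assms by (intro permutes_compose permutes_swap_id) auto
  moreover have "swap_pair x y (- i) = - swap_pair x y i" for i
    unfolding swap_pair_def using assms by (auto simp: transpose_def)
  ultimately show ?thesis by (simp add: odd_perms_def)
qed

lemma flip_odd_perms:
  assumes "{x, - x} \<subseteq> S"
  shows "transpose x (- x) \<in> odd_perms S"
  using assms permutes_swap_id[of x S "- x"] by (auto simp: odd_perms_def transpose_def)

text \<open>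
  A linear character of the signed permutations of \<open>U\<close>: \<open>r\<close> is its value at the class of the simple
  reflections of type A, and \<open>s\<close> its value at the sign changes of one coordinate.
\<close>

locale signed_char =
  fixes U :: "int set" and g :: "(int \<Rightarrow> int) \<Rightarrow> 'a :: comm_ring_1" and r s :: 'a
  assumes sym_U: "sym_set U"
    and g_id: "g id = 1"
    and g_comp: "w \<in> odd_perms U \<Longrightarrow> w' \<in> odd_perms U \<Longrightarrow> g (w \<circ> w') = g w * g w'"
    and g_swap: "x \<in> U \<Longrightarrow> y \<in> U \<Longrightarrow> \<bar>x\<bar> \<noteq> \<bar>y\<bar> \<Longrightarrow> g (swap_pair x y) = r"
    and g_flip: "x \<in> U \<Longrightarrow> g (transpose x (- x)) = s"
begin

text \<open>A one-point cycle is the identity or a sign change, and prefixing \<open>x\<close> to a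
  cycle that starts at \<open>y\<close> is multiplication by \<open>swap_pair x y\<close>. So m - 1
  swaps and at most one sign change are used, from which the value of \<open>g\<close> can be read
  off.\<close>

lemma cycle_exists:
  assumes "xs \<noteq> []" "distinct (map abs xs)" "set xs \<subseteq> U" "e \<in> Z2"
  obtains c where "c \<in> odd_perms (abs_closure xs)" "chain_of c xs" "c (last xs) = e * hd xs"
    "g c = r ^ (length xs - 1) * (if e = 1 then 1 else s)"
  using assms
proof (induction xs arbitrary: thesis rule: list_nonempty_induct)
  case (single x)
  show ?case
  proof (cases "e = 1")
    case True
    then show ?thesis by (intro single(1)[of id]) (simp_all add: g_id chain_of_def del: id_apply, simp)
  next
    case False
    then have "e = - 1" using single by (simp add: Z2_iff)
    then show ?thesis
      using single by (intro single(1)[of "transpose x (- x)"])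
        (auto simp: g_flip chain_of_def abs_closure_Cons intro!: flip_odd_perms)
  qed
next
  case (cons x xs)
  obtain c where c: "c \<in> odd_perms (abs_closure xs)" "chain_of c xs" "c (last xs) = e * hd xs"
    "g c = r ^ (length xs - 1) * (if e = 1 then 1 else s)"
    using cons.IH cons.prems by (auto simp del: distinct_map)
  obtain y ys where xs: "xs = y # ys" using cons.hyps by (cases xs) auto
  let ?t = "swap_pair x y"
  have xU: "x \<in> U" "y \<in> U" "\<bar>x\<bar> \<noteq> \<bar>y\<bar>" using cons.prems by (auto simp: xs)
  have nz: "x \<noteq> 0" "y \<noteq> 0" using xU sym_U by (auto simp: sym_set_def)
  have t: "?t \<in> odd_perms (abs_closure (x # xs))"
    using xU nz by (intro swap_pair_odd_perms) (auto simp: xs abs_closure_Cons)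
  have c': "c \<in> odd_perms (abs_closure (x # xs))"
    using c(1) odd_perms_mono[of "abs_closure xs" "abs_closure (x # xs)"] by (auto simp: abs_closure_Cons)
  have sub: "odd_perms (abs_closure (x # xs)) \<subseteq> odd_perms U"
    using cons.prems by (intro odd_perms_mono abs_closure_subset[OF sym_U]) auto
  have "x \<notin> abs_closure xs" using cons.prems by (auto simp: abs_closure_def)
  then have cx: "c x = x" using permutes_not_in[OF odd_permsD(1)[OF c(1)]] by blast
  \<comment> \<open>Composing with \<open>?t\<close> inserts \<open>x\<close> in front of
    \<open>y\<close>: the fixed point \<open>x\<close> is now sent to \<open>y\<close>, and the
    closing arrow to \<open>e * y\<close> is redirected to \<open>e * x\<close>.\<close>
  have tx: "?t x = y" and ty: "?t y = x"
    using nz xU(3) by (auto simp: swap_pair_def transpose_def)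
  show ?case
  proof (rule cons.prems(1))
    show "?t \<circ> c \<in> odd_perms (abs_closure (x # xs))" using t c' by (rule odd_perms_comp)
    have "(?t \<circ> c) ((x # xs) ! i) = (x # xs) ! Suc i" if "Suc i < length (x # xs)" for i
    proof (cases i)
      case 0
      then show ?thesis by (simp add: cx tx xs)
    next
      case (Suc j)
      with that have j: "Suc j < length xs" by simp
      have "map abs (x # xs) ! Suc (Suc j) \<noteq> map abs (x # xs) ! 0"
        "map abs (x # xs) ! Suc (Suc j) \<noteq> map abs (x # xs) ! 1"
        using cons.prems(2) j by (subst nth_eq_iff_index_eq; force)+
      then have "\<bar>xs ! Suc j\<bar> \<noteq> \<bar>x\<bar>" "\<bar>xs ! Suc j\<bar> \<noteq> \<bar>y\<bar>" using j by (auto simp: xs)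
      then have "?t (xs ! Suc j) = xs ! Suc j"
        by (auto simp: swap_pair_def transpose_def)
      moreover have "c (xs ! j) = xs ! Suc j" using c(2) j by (simp add: chain_of_def)
      ultimately show ?thesis by (simp add: Suc)
    qed
    then show "chain_of (?t \<circ> c) (x # xs)" by (simp add: chain_of_def)
    show "(?t \<circ> c) (last (x # xs)) = e * hd (x # xs)"
      using c(3) odd_perms_scale[OF t cons.prems(4)] ty by (simp add: xs)
    have "g (?t \<circ> c) = g ?t * g c"
      using t c' sub by (intro g_comp) auto
    then show "g (?t \<circ> c) = r ^ (length (x # xs) - 1) * (if e = 1 then 1 else s)"
      using xU by (simp add: g_swap c(4) xs)
  qed
qed

end

locale weighted_signed_char = signed_char U g r s
  for U and g :: "(int \<Rightarrow> int) \<Rightarrow> 'a :: comm_ring_1" and r s +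
  fixes v :: "nat \<times> int \<Rightarrow> 'a"
begin

text \<open>The product runs over positive points instead of cycles, so that a cycle of length m
  contributes the m-th power of its variable, as in \<open>t_monom\<close>.\<close>

definition weight :: "int set \<Rightarrow> (int \<Rightarrow> int) \<Rightarrow> 'a" where
  "weight S w = g w * (\<Prod>i\<in>pos_part S. v (ctype w i))"

text \<open>The share of a single signed cycle: the value of \<open>g\<close> from
  \<open>cycle_exists\<close>, and one factor \<open>v\<close> for each of the m positive
  entries.\<close>

definition cycle_weight :: "nat \<Rightarrow> int \<Rightarrow> 'a" where
  "cycle_weight m e = r ^ (m - 1) * (if e = 1 then 1 else s) * v (m, e) ^ m"

text \<open>On the closure of \<open>xs\<close> such a \<open>w\<close> agrees with the fixed cycle
  \<open>c\<close> of \<open>cycle_exists\<close>, since its values on \<open>xs\<close> and oddness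
  determine it there. So \<open>w\<close> is \<open>c\<close> composed with a signed permutation of
  the complement, and both \<open>g\<close> and the product over points factor accordingly.\<close>

lemma sum_closed_chain:
  assumes S: "sym_set S" "S \<subseteq> U" and xs: "xs \<noteq> []" "distinct (map abs xs)" "set xs \<subseteq> S" and e: "e \<in> Z2"
  shows "(\<Sum>w | w \<in> odd_perms S \<and> chain_of w xs \<and> w (last xs) = e * hd xs. weight S w)
    = cycle_weight (length xs) e * (\<Sum>w\<in>odd_perms (S - abs_closure xs). weight (S - abs_closure xs) w)"
proof -
  define C where "C = abs_closure xs"
  have 0: "0 \<notin> set xs" using xs S by (auto simp: sym_set_def)
  have C: "sym_set C" "C \<subseteq> S" unfolding C_def
    using sym_set_abs_closure[OF 0] abs_closure_subset[OF S(1) xs(3)] by auto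
  obtain c where c: "c \<in> odd_perms C" "chain_of c xs" "c (last xs) = e * hd xs"
    "g c = r ^ (length xs - 1) * (if e = 1 then 1 else s)"
    using cycle_exists[of xs e] xs S e unfolding C_def by blast
  have CS: "odd_perms C \<subseteq> odd_perms S" and DS: "odd_perms (S - C) \<subseteq> odd_perms S" and SU: "odd_perms S \<subseteq> odd_perms U"
    using C S by (auto intro!: odd_perms_mono)
  have agree: "w x = c x" if w: "w \<in> odd_perms S" "chain_of w xs" "w (last xs) = e * hd xs" and x: "x \<in> C" for w x
  proof -
    have eq: "w y = c y" if y: "y \<in> set xs" for y
    proof -
      obtain i where i: "i < length xs" "y = xs ! i" using y by (auto simp: in_set_conv_nth)
      show ?thesis
      proof (cases "Suc i < length xs")
        case True
        then show ?thesis using i w(2) c(2) by (simp add: chain_of_def)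
      next
        case False
        then have "Suc i = length xs" using i by simp
        then have "y = last xs" using i xs(1) by (metis diff_Suc_1 last_conv_nth)
        then show ?thesis using w(3) c(3) by simp
      qed
    qed
    show ?thesis
      using x eq odd_permsD(2)[OF w(1)] odd_permsD(2)[OF c(1)] unfolding C_def abs_closure_conv by auto
  qed
  have inv_comp: "Hilbert_Choice.inv c \<circ> w \<in> odd_perms (S - C)"
    if w: "w \<in> odd_perms S" "chain_of w xs" "w (last xs) = e * hd xs" for w
  proof -
    have d: "Hilbert_Choice.inv c \<circ> w \<in> odd_perms S"
      using odd_perms_inv[OF c(1)] CS w by (intro odd_perms_comp) auto
    have "(Hilbert_Choice.inv c \<circ> w) permutes (S - C)"
    proof (rule permutes_superset[OF odd_permsD(1)[OF d]])
      fix x assume "x \<in> S - (S - C)"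
      then have "x \<in> C" by auto
      then show "(Hilbert_Choice.inv c \<circ> w) x = x"
        using agree[OF w] permutes_inverses(2)[OF odd_permsD(1)[OF c(1)]] by simp
    qed
    then show ?thesis using odd_permsD(2)[OF d] by (simp add: odd_perms_def)
  qed
  have "(\<Sum>w | w \<in> odd_perms S \<and> chain_of w xs \<and> w (last xs) = e * hd xs. weight S w)
      = (\<Sum>w\<in>odd_perms (S - C). cycle_weight (length xs) e * weight (S - C) w)"
  proof (rule sum.reindex_bij_witness[where i = "\<lambda>w. c \<circ> w" and j = "\<lambda>w. Hilbert_Choice.inv c \<circ> w"], goal_cases)
    case (1 w)
    then show ?case using permutes_inv_o(1)[OF odd_permsD(1)[OF c(1)]] by (simp flip: comp_assoc)
  next
    case (2 w)
    then have w: "w \<in> odd_perms S" "chain_of w xs" "w (last xs) = e * hd xs" by auto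
    then show ?case by (rule inv_comp)
  next
    case (3 w)
    then show ?case using permutes_inv_o(2)[OF odd_permsD(1)[OF c(1)]] by (simp flip: comp_assoc)
  next
    case (4 w)
    then show ?case
      using chain_of_comp[OF S(1) xs(1,3) c(1-3)[unfolded C_def]] by (simp add: C_def)
  next
    case (5 w)
    then have w: "w \<in> odd_perms S" "chain_of w xs" "w (last xs) = e * hd xs" by auto
    define w' where "w' = Hilbert_Choice.inv c \<circ> w"
    have w_eq: "w = c \<circ> w'"
      unfolding w'_def using permutes_inv_o(1)[OF odd_permsD(1)[OF c(1)]] by (simp flip: comp_assoc)
    have w': "w' \<in> odd_perms (S - C)" unfolding w'_def using w by (rule inv_comp)
    have "g w = g c * g w'"
      unfolding w_eq using c(1) w' CS DS SU by (intro g_comp) auto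
    moreover have "(\<Prod>i\<in>pos_part S. v (ctype w i))
        = (\<Prod>i\<in>pos_part (S - C). v (ctype w i)) * (\<Prod>i\<in>pos_part C. v (ctype w i))"
      unfolding pos_part_Diff
      by (rule prod.subset_diff) (use C S in \<open>auto intro: finite_pos_part simp: pos_part_mono\<close>)
    moreover have "(\<Prod>i\<in>pos_part (S - C). v (ctype w i)) = (\<Prod>i\<in>pos_part (S - C). v (ctype w' i))"
      by (rule prod.cong) (auto simp: w_eq pos_part_def ctype_comp[OF c(1) w'])
    moreover have "(\<Prod>i\<in>pos_part C. v (ctype w i)) = (\<Prod>i\<in>pos_part C. v (length xs, e))"
      by (rule prod.cong)
        (auto simp: C_def pos_part_def ctype_chain_of[OF S(1) w(1) xs(3,1,2) w(2,3) e])
    moreover have "card (pos_part C) = length xs"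
      unfolding C_def by (rule card_pos_part_abs_closure) (use 0 xs in auto)
    ultimately show ?case
      by (simp add: weight_def cycle_weight_def c(4) w'_def[symmetric] ac_simps)
  qed
  then show ?thesis by (simp add: C_def sum_distrib_left)
qed

end

context weighted_signed_char
begin

text \<open>
  The summands are sorted by the cycle through \<open>hd xs\<close>, which either closes up to \<open>\<plusminus>hd xs\<close> right
  after \<open>last xs\<close> or visits one further point.
\<close>

lemma sum_chain_step:
  assumes S: "sym_set S" "S \<subseteq> U" and xs: "xs \<noteq> []" "distinct (map abs xs)" "set xs \<subseteq> S"
  shows "(\<Sum>w | w \<in> odd_perms S \<and> chain_of w xs. weight S w)
    = (cycle_weight (length xs) 1 + cycle_weight (length xs) (- 1))
        * (\<Sum>w\<in>odd_perms (S - abs_closure xs). weight (S - abs_closure xs) w)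
      + (\<Sum>y\<in>S - abs_closure xs. \<Sum>w | w \<in> odd_perms S \<and> chain_of w (xs @ [y]). weight S w)"
proof -
  define C where "C = abs_closure xs"
  define A where "A = {w. w \<in> odd_perms S \<and> chain_of w xs}"
  define P where "P y = (\<Sum>w\<in>{w \<in> A. w (last xs) = y}. weight S w)" for y
  have fin: "finite S" "finite A"
    using S by (auto simp: sym_set_def A_def intro: finite_subset[OF _ finite_odd_perms[of S]])
  have hd_set: "hd xs \<in> set xs" "last xs \<in> set xs" using xs(1) by auto
  then have hd: "hd xs \<in> S" "hd xs \<in> C" "last xs \<in> S" "hd xs \<noteq> 0"
    using xs(3) S(1) set_subset_abs_closure by (auto simp: sym_set_def C_def)
  \<comment> \<open>Any other point of \<open>C\<close> is, up to sign, already the image of an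
    entry before the last one, so oddness and injectivity exclude it.\<close>
  have target: "y \<in> {hd xs, - hd xs} \<union> (S - C)" if w: "w \<in> A" and y: "y = w (last xs)" for w y
  proof (rule ccontr)
    assume *: "y \<notin> {hd xs, - hd xs} \<union> (S - C)"
    have wS: "w \<in> odd_perms S" "chain_of w xs" using w by (auto simp: A_def)
    have "y \<in> S" using y hd odd_perms_in_iff[OF wS(1)] by simp
    with * have "y \<in> C" by auto
    then obtain i where i: "i < length xs" "\<bar>y\<bar> = \<bar>xs ! i\<bar>"
      unfolding C_def abs_closure_def by (auto simp: in_set_conv_nth)
    have "i \<noteq> 0"
    proof
      assume "i = 0"
      then have "\<bar>y\<bar> = \<bar>hd xs\<bar>" using i xs(1) by (simp add: hd_conv_nth)
      then show False using * by (auto simp: abs_eq_iff)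
    qed
    then obtain j where j: "i = Suc j" by (cases i) auto
    then have "\<bar>w (last xs)\<bar> = \<bar>w (xs ! j)\<bar>" using i y wS(2) by (simp add: chain_of_def)
    then have "\<bar>xs ! (length xs - 1)\<bar> = \<bar>xs ! j\<bar>"
      using odd_perms_abs_eq_iff[OF wS(1)] xs(1) by (simp add: last_conv_nth)
    then have "map abs xs ! (length xs - 1) = map abs xs ! j" using i j by simp
    then show False using xs i j by (subst (asm) nth_eq_iff_index_eq) auto
  qed
  have "(\<Sum>w\<in>A. weight S w) = (\<Sum>y\<in>{hd xs, - hd xs} \<union> (S - C). P y)"
    unfolding P_def by (rule sum.group[symmetric]) (use fin target in auto)
  also have "\<dots> = P (hd xs) + P (- hd xs) + (\<Sum>y\<in>S - C. P y)"
  proof -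
    have "- hd xs \<in> C" using hd(2) by (simp add: C_def abs_closure_def)
    then have "{hd xs, - hd xs} \<inter> (S - C) = {}" using hd by auto
    then show ?thesis using fin hd(4) by (subst sum.union_disjoint) auto
  qed
  also have "P (hd xs) = cycle_weight (length xs) 1 * (\<Sum>w\<in>odd_perms (S - C). weight (S - C) w)"
    using sum_closed_chain[OF S xs, of 1] by (simp add: P_def A_def C_def Z2_iff conj_ac)
  also have "P (- hd xs) = cycle_weight (length xs) (- 1) * (\<Sum>w\<in>odd_perms (S - C). weight (S - C) w)"
    using sum_closed_chain[OF S xs, of "- 1"] by (simp add: P_def A_def C_def Z2_iff conj_ac)
  also have "(\<Sum>y\<in>S - C. P y) = (\<Sum>y\<in>S - C. \<Sum>w | w \<in> odd_perms S \<and> chain_of w (xs @ [y]). weight S w)"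
  proof (rule sum.cong[OF refl])
    fix y
    have "chain_of w (xs @ [y]) \<longleftrightarrow> chain_of w xs \<and> w (last xs) = y" for w
    proof
      assume *: "chain_of w (xs @ [y])"
      have "w (xs ! i) = xs ! Suc i" if "Suc i < length xs" for i
        using *[unfolded chain_of_def, rule_format, of i] that by (simp add: nth_append)
      moreover have "w (last xs) = y"
        using *[unfolded chain_of_def, rule_format, of "length xs - 1"] xs(1)
        by (simp add: nth_append last_conv_nth)
      ultimately show "chain_of w xs \<and> w (last xs) = y" by (simp add: chain_of_def)
    next
      assume *: "chain_of w xs \<and> w (last xs) = y"
      show "chain_of w (xs @ [y])"
        unfolding chain_of_def
      proof (intro allI impI)
        fix i assume "Suc i < length (xs @ [y])"
        then consider "Suc i < length xs" | "Suc i = length xs" by force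
        then show "w ((xs @ [y]) ! i) = (xs @ [y]) ! Suc i"
        proof cases
          case 1
          then show ?thesis using * by (simp add: nth_append chain_of_def)
        next
          case 2
          then have "i = length xs - 1" by simp
          then show ?thesis using * 2 xs(1) by (simp add: nth_append last_conv_nth)
        qed
      qed
    qed
    then show "P y = (\<Sum>w | w \<in> odd_perms S \<and> chain_of w (xs @ [y]). weight S w)"
      by (auto simp: P_def A_def intro: sum.cong)
  qed
  finally show ?thesis by (simp add: A_def C_def ring_distribs)
qed

text \<open>\<open>E\<close> is only required to solve the recursion, so nothing has to be divided
  by 2 n in the ring. The outer induction on n treats the complement of a closed cycle; an inner one
  reveals the cycle through a point entry by entry.\<close>

theorem sum_weight:
  fixes E :: "nat \<Rightarrow> 'a"
  assumes E0: "E 0 = 1"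
    and E: "\<And>n. 2 * of_nat n * E n = (\<Sum>m=1..n. (cycle_weight m 1 + cycle_weight m (- 1)) * E (n - m))"
    and S: "sym_set S" "S \<subseteq> U" "card (pos_part S) = n"
  shows "(\<Sum>w\<in>odd_perms S. weight S w) = of_nat (2 ^ n * fact n) * E n"
  using S
proof (induction n arbitrary: S rule: less_induct)
  case (less n)
  note IH = less.IH and S = less.prems
  define cw where "cw m = cycle_weight m 1 + cycle_weight m (- 1)" for m
  \<comment> \<open>With m entries fixed, closing the chain contributes the term l = m of the
    recursion, and each of the 2 (n - m) possible extensions supplies the same tail l > m.\<close>
  have chain: "(\<Sum>w | w \<in> odd_perms S \<and> chain_of w xs. weight S w)
      = of_nat (2 ^ (n - length xs) * fact (n - length xs)) * (\<Sum>m=length xs..n. cw m * E (n - m))"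
    if "xs \<noteq> []" "distinct (map abs xs)" "set xs \<subseteq> S" for xs
    using that
  proof (induction "n - length xs" arbitrary: xs rule: less_induct)
    case (less xs)
    note xs = less.prems
    define C where "C = abs_closure xs"
    define m where "m = length xs"
    have 0: "0 \<notin> set xs" using xs S by (auto simp: sym_set_def)
    have C: "sym_set C" "C \<subseteq> S" unfolding C_def
      using sym_set_abs_closure[OF 0] abs_closure_subset[OF S(1) xs(3)] by auto
    have cardC: "card (pos_part C) = m"
      unfolding C_def m_def using 0 xs(2) by (rule card_pos_part_abs_closure)
    have "m \<le> n" using S C cardC by (metis card_mono finite_pos_part pos_part_mono)
    have "0 < m" using xs by (simp add: m_def)
    have card: "card (pos_part (S - C)) = n - m"
      using C S cardC by (simp add: pos_part_Diff card_Diff_subset finite_pos_part pos_part_mono)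
    have symD: "sym_set (S - C)" using sym_set_Diff[OF S(1) C(1)] .
    have D: "(\<Sum>w\<in>odd_perms (S - C). weight (S - C) w) = of_nat (2 ^ (n - m) * fact (n - m)) * E (n - m)"
      using IH[of "n - m" "S - C"] S symD card \<open>0 < m\<close> \<open>m \<le> n\<close> by auto
    let ?R = "\<Sum>l=Suc m..n. cw l * E (n - l)"
    have "(\<Sum>y\<in>S - C. \<Sum>w | w \<in> odd_perms S \<and> chain_of w (xs @ [y]). weight S w)
        = of_nat (2 ^ (n - m) * fact (n - m)) * ?R"
    proof (cases "n = m")
      case True
      then have D_empty: "S - C = {}"
        using card card_sym_set[OF symD] symD by (simp add: sym_set_def)
      show ?thesis unfolding D_empty using True by simp
    next
      case False
      then obtain d where d: "n - m = Suc d" using \<open>m \<le> n\<close> by (cases "n - m") auto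
      have "(\<Sum>y\<in>S - C. \<Sum>w | w \<in> odd_perms S \<and> chain_of w (xs @ [y]). weight S w)
          = (\<Sum>y\<in>S - C. of_nat (2 ^ d * fact d) * ?R)"
      proof (rule sum.cong[OF refl])
        fix y assume y: "y \<in> S - C"
        have "n - length (xs @ [y]) = d" "length (xs @ [y]) = Suc m" using d by (simp_all add: m_def)
        moreover have "distinct (map abs (xs @ [y]))" "set (xs @ [y]) \<subseteq> S"
          using y xs by (auto simp: C_def abs_closure_def)
        ultimately show "(\<Sum>w | w \<in> odd_perms S \<and> chain_of w (xs @ [y]). weight S w)
            = of_nat (2 ^ d * fact d) * ?R"
          using less.hyps[of "xs @ [y]"] d by (simp add: m_def)
      qed
      also have "\<dots> = of_nat (card (S - C) * (2 ^ d * fact d)) * ?R"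
        by (simp add: mult.assoc)
      \<comment> \<open>Here \<open>card (S - C)\<close> is 2 (n - m) = 2 (d + 1): the next entry
        may be any remaining point of either sign.\<close>
      also have "card (S - C) * (2 ^ d * fact d) = 2 ^ (n - m) * fact (n - m)"
        unfolding card_sym_set[OF symD] card d by (simp add: algebra_simps)
      finally show ?thesis .
    qed
    then have "(\<Sum>w | w \<in> odd_perms S \<and> chain_of w xs. weight S w)
        = of_nat (2 ^ (n - m) * fact (n - m)) * (cw m * E (n - m) + ?R)"
      using sum_chain_step[OF S(1,2) xs] D
      by (simp add: cw_def C_def[symmetric] m_def[symmetric] algebra_simps)
    also have "cw m * E (n - m) + ?R = (\<Sum>l=m..n. cw l * E (n - l))"
      using \<open>m \<le> n\<close> by (simp add: sum.atLeast_Suc_atMost)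
    finally show ?case by (simp add: m_def)
  qed
  show ?case
  proof (cases n)
    case 0
    then have "S = {}" using S card_sym_set[OF S(1)] by (simp add: sym_set_def)
    then have "odd_perms S = {id}" by (auto simp: odd_perms_def)
    then show ?thesis using 0 E0 \<open>S = {}\<close> by (simp add: weight_def g_id[unfolded id_def] pos_part_def id_def)
  next
    case (Suc d)
    then have "S \<noteq> {}" using S by (auto simp: pos_part_def)
    then obtain x where x: "x \<in> S" by auto
    \<comment> \<open>The condition \<open>chain_of w [x]\<close> is empty, so the formula for
      chains of length 1 already sums over all of \<open>odd_perms S\<close>.\<close>
    have "(\<Sum>w\<in>odd_perms S. weight S w) = of_nat (2 ^ d * fact d) * (\<Sum>m=1..n. cw m * E (n - m))"
      using chain[of "[x]"] x Suc by (simp add: chain_of_def)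
    also have "\<dots> = of_nat (2 ^ d * fact d) * (2 * of_nat n * E n)"
      using E[of n] by (simp add: cw_def)
    also have "\<dots> = of_nat (2 ^ n * fact n) * E n"
      by (simp add: Suc algebra_simps)
    finally show ?thesis .
  qed
qed

end

section \<open>Cycle types and conjugacy\<close>

text \<open>Counting points instead of cycles makes the count additive when a union of cycles is
  removed; each cycle is counted as often as its length, see
  \<open>type_count_eq_parts_of\<close>.\<close>

definition type_count :: "int set \<Rightarrow> (int \<Rightarrow> int) \<Rightarrow> nat \<times> int \<Rightarrow> nat" where
  "type_count S w t = card {i \<in> pos_part S. ctype w i = t}"

lemma type_count_Diff:
  assumes "sym_set S" "C \<subseteq> S"
  shows "type_count S w t = type_count C w t + type_count (S - C) w t"
proof -
  define A where "A = {i \<in> pos_part C. ctype w i = t}"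
  define B where "B = {i \<in> pos_part (S - C). ctype w i = t}"
  have AB: "{i \<in> pos_part S. ctype w i = t} = A \<union> B"
    using assms(2) by (auto simp: A_def B_def pos_part_def)
  have "finite S" "finite C" using assms finite_subset[of C S] by (auto simp: sym_set_def)
  then have "finite A" "finite B" by (simp_all add: A_def B_def pos_part_def)
  moreover have "A \<inter> B = {}" by (auto simp: A_def B_def pos_part_def)
  ultimately show ?thesis
    unfolding type_count_def AB A_def[symmetric] B_def[symmetric] by (rule card_Un_disjoint)
qed

lemma type_count_const:
  assumes "\<And>i. i \<in> C \<Longrightarrow> ctype w i = t'"
  shows "type_count C w t = (if t = t' then card (pos_part C) else 0)"
proof -
  have "{i \<in> pos_part C. ctype w i = t} = (if t = t' then pos_part C else {})"
    using assms by (auto simp: pos_part_def)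
  then show ?thesis by (simp add: type_count_def)
qed

section \<open>Signed cycles as point sets, and conjugating maps between them\<close>

definition scycle :: "(int \<Rightarrow> int) \<Rightarrow> int \<Rightarrow> int set" where
  "scycle w x = {d * (w ^^ i) x | d i. d \<in> Z2}"

lemma scycleI: "d \<in> Z2 \<Longrightarrow> d * (w ^^ i) x \<in> scycle w x"
  by (auto simp: scycle_def)

lemma scycleE:
  assumes "y \<in> scycle w x"
  obtains d i where "d \<in> Z2" "y = d * (w ^^ i) x"
  using assms by (auto simp: scycle_def)

lemma self_in_scycle: "x \<in> scycle w x"
  using scycleI[of 1 0 w x] by (simp add: Z2_iff)

lemma Z2_mult: "d \<in> Z2 \<Longrightarrow> e \<in> Z2 \<Longrightarrow> d * e \<in> Z2"
  by (auto simp: Z2_iff)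

context
  fixes S w x
  assumes S: "sym_set S" and w: "w \<in> odd_perms S" and x: "x \<in> S"
begin

lemma scycle_subset:
  assumes "T \<subseteq> S" "sym_set T" "w ` T \<subseteq> T" "x \<in> T"
  shows "scycle w x \<subseteq> T"
proof
  have "(w ^^ i) x \<in> T" for i
    using assms by (induction i) auto
  then show "y \<in> T" if "y \<in> scycle w x" for y
    using that assms by (auto simp: scycle_def Z2_iff sym_set_def)
qed

lemma scycle_subset_S: "scycle w x \<subseteq> S"
  using S x odd_perms_in_iff[OF w] by (intro scycle_subset) auto

lemma sym_set_scycle: "sym_set (scycle w x)"
proof -
  have "- y \<in> scycle w x" if y: "y \<in> scycle w x" for y
  proof -
    from y obtain d i where "d \<in> Z2" "y = d * (w ^^ i) x" by (rule scycleE)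
    then show ?thesis using scycleI[of "- d" i w x] by (auto simp: Z2_iff)
  qed
  moreover have "finite (scycle w x)" "0 \<notin> scycle w x"
    using scycle_subset_S S finite_subset by (auto simp: sym_set_def)
  ultimately show ?thesis by (auto simp: sym_set_def)
qed

lemma scycle_image: "w ` scycle w x = scycle w x"
proof (rule endo_inj_surj)
  show "finite (scycle w x)" using sym_set_scycle by (simp add: sym_set_def)
  show "w ` scycle w x \<subseteq> scycle w x"
  proof
    fix y assume "y \<in> w ` scycle w x"
    then obtain d i where "d \<in> Z2" "y = w (d * (w ^^ i) x)" by (auto simp: scycle_def)
    then show "y \<in> scycle w x" using scycleI[of d "Suc i" w x] by (simp add: odd_perms_scale[OF w])
  qed
  show "inj_on w (scycle w x)" using odd_permsD(3)[OF w] by (auto intro: inj_on_subset)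
qed

lemma scycle_complement:
  assumes "w ` T \<subseteq> T"
  shows "w ` (T - scycle w x) \<subseteq> T - scycle w x"
proof
  fix y assume "y \<in> w ` (T - scycle w x)"
  then obtain z where z: "z \<in> T" "z \<notin> scycle w x" "y = w z" by auto
  then have "y \<notin> w ` scycle w x" using inj_eq[OF odd_permsD(3)[OF w]] by auto
  then show "y \<in> T - scycle w x" using z assms scycle_image by auto
qed

lemma ctype_scycle:
  assumes "y \<in> scycle w x"
  shows "ctype w y = ctype w x"
proof -
  have *: "(w ^^ i) x \<in> S" for i using odd_perms_in_iff[OF odd_perms_funpow[OF w]] x by blast
  then have "ctype w ((w ^^ i) x) = ctype w x" for i
    by (induction i) (auto simp: ctype_step[OF S w])
  then show ?thesis using assms * ctype_uminus[OF S w] by (auto simp: scycle_def Z2_iff)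
qed

text \<open>The pairs (d, i) serve as coordinates on a signed cycle. Which pairs name the same point
  depends on \<open>ctype w x\<close> alone, so the coordinates can be carried over to any cycle of
  equal type.\<close>

lemma scycle_eq_iff:
  assumes "d \<in> Z2" "d' \<in> Z2" "j \<le> i"
  shows "d * (w ^^ i) x = d' * (w ^^ j) x
    \<longleftrightarrow> clen w x dvd (i - j) \<and> d * d' = csgn w x ^ ((i - j) div clen w x)"
proof -
  have wj: "w ^^ j \<in> odd_perms S" using w by (rule odd_perms_funpow)
  have "(w ^^ i) x = (w ^^ j) ((w ^^ (i - j)) x)"
    using assms(3) by (metis comp_apply funpow_add le_add_diff_inverse)
  then have "d * (w ^^ i) x = d' * (w ^^ j) x \<longleftrightarrow> (w ^^ j) (d * (w ^^ (i - j)) x) = (w ^^ j) (d' * x)"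
    using assms by (simp add: odd_perms_scale[OF wj])
  also have "\<dots> \<longleftrightarrow> d * (w ^^ (i - j)) x = d' * x"
    using inj_eq[OF odd_permsD(3)[OF wj]] .
  also have "\<dots> \<longleftrightarrow> (w ^^ (i - j)) x = (d * d') * x"
    using assms by (auto simp: Z2_iff)
  finally show ?thesis
    using funpow_eq_scale_iff[OF S w x Z2_mult[OF assms(1,2)]] by simp
qed

end

lemma scycle_transfer:
  assumes "sym_set S" "w \<in> odd_perms S" "x \<in> S" "sym_set S'" "w' \<in> odd_perms S'" "x' \<in> S'"
    and "ctype w x = ctype w' x'" "d \<in> Z2" "d' \<in> Z2"
  shows "d * (w ^^ i) x = d' * (w ^^ j) x \<longleftrightarrow> d * (w' ^^ i) x' = d' * (w' ^^ j) x'"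
proof (cases "j \<le> i")
  case True
  then show ?thesis using assms by (simp add: scycle_eq_iff ctype_def)
next
  case False
  then have "d' * (w ^^ j) x = d * (w ^^ i) x \<longleftrightarrow> d' * (w' ^^ j) x' = d * (w' ^^ i) x'"
    using assms by (simp add: scycle_eq_iff ctype_def)
  then show ?thesis by (auto simp: eq_commute)
qed

text \<open>Send each point to the one with the same coordinates. \<open>scycle_transfer\<close>
  makes this well defined in one direction and injective in the other; negation and \<open>w\<close>
  act on the coordinates in the same way on both sides.\<close>

lemma scycle_conjugator:
  assumes "sym_set S" "w \<in> odd_perms S" "x \<in> S" "sym_set S'" "w' \<in> odd_perms S'" "x' \<in> S'"
    and "ctype w x = ctype w' x'"
  obtains z where "bij_betw z (scycle w x) (scycle w' x')"
    "\<And>y. y \<in> scycle w x \<Longrightarrow> z (- y) = - z y \<and> z (w y) = w' (z y)"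
proof -
  define z where "z y = (SOME y'. \<exists>d i. d \<in> Z2 \<and> y = d * (w ^^ i) x \<and> y' = d * (w' ^^ i) x')" for y
  have z: "z (d * (w ^^ i) x) = d * (w' ^^ i) x'" if "d \<in> Z2" for d i
    unfolding z_def
  proof (rule some_equality)
    fix y' assume "\<exists>d' j. d' \<in> Z2 \<and> d * (w ^^ i) x = d' * (w ^^ j) x \<and> y' = d' * (w' ^^ j) x'"
    then obtain d' j where "d' \<in> Z2" "d * (w ^^ i) x = d' * (w ^^ j) x" "y' = d' * (w' ^^ j) x'" by blast
    then show "y' = d * (w' ^^ i) x'" using scycle_transfer[OF assms that, of d' i j] by simp
  qed (use that in blast)
  show ?thesis
  proof
    show "bij_betw z (scycle w x) (scycle w' x')"
      unfolding bij_betw_def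
    proof
      show "inj_on z (scycle w x)"
      proof (rule inj_onI)
        fix y y' assume "y \<in> scycle w x" "y' \<in> scycle w x" and eq: "z y = z y'"
        then obtain d i d' j where "d \<in> Z2" "y = d * (w ^^ i) x" "d' \<in> Z2" "y' = d' * (w ^^ j) x"
          by (metis scycleE)
        then show "y = y'" using scycle_transfer[OF assms, of d d' i j] eq z by simp
      qed
      show "z ` scycle w x = scycle w' x'"
      proof (rule equalityI; rule subsetI)
        fix y assume "y \<in> scycle w' x'"
        then obtain d i where di: "d \<in> Z2" "y = d * (w' ^^ i) x'" by (rule scycleE)
        then show "y \<in> z ` scycle w x" using z scycleI by (metis image_eqI)
      next
        fix y assume "y \<in> z ` scycle w x"
        then obtain d i where "d \<in> Z2" "y = z (d * (w ^^ i) x)" by (auto simp: scycle_def)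
        then show "y \<in> scycle w' x'" by (simp add: z scycleI)
      qed
    qed
    fix y assume "y \<in> scycle w x"
    then obtain d i where di: "d \<in> Z2" "y = d * (w ^^ i) x" by (rule scycleE)
    then have "z (- y) = - z y" using z[of "- d" i] z[of d i] by (auto simp: Z2_iff)
    moreover have "w y = d * (w ^^ Suc i) x" "w' (z y) = d * (w' ^^ Suc i) x'"
      using di by (simp_all add: odd_perms_scale[OF assms(2)] odd_perms_scale[OF assms(5)] z)
    then have "z (w y) = w' (z y)" using z[OF di(1), of "Suc i"] by simp
    ultimately show "z (- y) = - z y \<and> z (w y) = w' (z y)" ..
  qed
qed

text \<open>Cycles are matched and removed one at a time, equal counts guaranteeing a partner of the
  same type. Two sets are needed because matched cycles may occupy different points, even when both
  sets are \<open>S\<close> at the start.\<close>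

lemma conjugator_on:
  assumes S: "sym_set S" and w: "w \<in> odd_perms S" "w' \<in> odd_perms S"
    and T: "T \<subseteq> S" "sym_set T" "w ` T \<subseteq> T" and T': "T' \<subseteq> S" "sym_set T'" "w' ` T' \<subseteq> T'"
    and count: "\<And>t. type_count T w t = type_count T' w' t"
  obtains z where "bij_betw z T T'" "\<And>y. y \<in> T \<Longrightarrow> z (- y) = - z y \<and> z (w y) = w' (z y)"
  using T T' count
proof (induction "card T" arbitrary: T T' thesis rule: less_induct)
  case less
  note T = less.prems(2-4) and T' = less.prems(5-7) and count = less.prems(8)
  have fin: "finite T" "finite T'" using T T' by (auto simp: sym_set_def)
  show ?case
  proof (cases "T = {}")
    case True
    have "pos_part T' = {}"
    proof (rule ccontr)
      assume "pos_part T' \<noteq> {}"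
      then obtain i where "i \<in> pos_part T'" by auto
      then have "0 < type_count T' w' (ctype w' i)"
        using fin by (auto simp: type_count_def card_gt_0_iff pos_part_def)
      then show False using count[of "ctype w' i"] True by (simp add: type_count_def pos_part_def)
    qed
    then have "T' = {}" using card_sym_set[OF T'(2)] fin by simp
    then show ?thesis using True by (intro less.prems(1)[of id]) auto
  next
    case False
    then have "pos_part T \<noteq> {}" using card_sym_set[OF T(2)] fin by auto
    then obtain x where x: "x \<in> pos_part T" by auto
    then have "0 < type_count T w (ctype w x)"
      using fin by (auto simp: type_count_def card_gt_0_iff pos_part_def)
    then obtain x' where x': "x' \<in> pos_part T'" "ctype w x = ctype w' x'"
      unfolding count by (auto simp: type_count_def card_gt_0_iff)
    have xT: "x \<in> T" "x' \<in> T'" "x \<in> S" "x' \<in> S" using x x' T T' by (auto simp: pos_part_def)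
    define C where "C = scycle w x"
    define C' where "C' = scycle w' x'"
    obtain z0 where z0: "bij_betw z0 C C'"
      "\<And>y. y \<in> C \<Longrightarrow> z0 (- y) = - z0 y \<and> z0 (w y) = w' (z0 y)"
      unfolding C_def C'_def using scycle_conjugator[OF S w(1) xT(3) S w(2) xT(4) x'(2)] by metis
    have C: "C \<subseteq> T" "sym_set C" "w ` C = C" "\<And>i. i \<in> C \<Longrightarrow> ctype w i = ctype w x"
      and C': "C' \<subseteq> T'" "sym_set C'" "\<And>i. i \<in> C' \<Longrightarrow> ctype w' i = ctype w x"
      unfolding C_def C'_def x'(2)
      using scycle_subset[OF S w(1) xT(3) T xT(1)] scycle_subset[OF S w(2) xT(4) T' xT(2)]
        sym_set_scycle[OF S w(1) xT(3)] sym_set_scycle[OF S w(2) xT(4)] scycle_image[OF S w(1) xT(3)]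
        ctype_scycle[OF S w(1) xT(3)] ctype_scycle[OF S w(2) xT(4)] x'(2) by auto
    have "card (pos_part C) = card (pos_part C')"
      using bij_betw_same_card[OF z0(1)] card_sym_set[OF C(2)] card_sym_set[OF C'(2)] by simp
    then have "type_count C w t = type_count C' w' t" for t
      using type_count_const[OF C(4)] type_count_const[OF C'(3)] by simp
    then have count': "type_count (T - C) w t = type_count (T' - C') w' t" for t
      using count[of t] type_count_Diff[OF T(2) C(1)] type_count_Diff[OF T'(2) C'(1)] by simp
    have "card (T - C) < card T"
      using C fin self_in_scycle[of x w] by (intro psubset_card_mono) (auto simp: C_def)
    moreover have TC: "T - C \<subseteq> S" "sym_set (T - C)" "w ` (T - C) \<subseteq> T - C"
      and "T' - C' \<subseteq> S" "sym_set (T' - C')" "w' ` (T' - C') \<subseteq> T' - C'"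
      using T T' sym_set_Diff[OF T(2) C(2)] sym_set_Diff[OF T'(2) C'(2)]
        scycle_complement[OF S w(1) xT(3) T(3)] scycle_complement[OF S w(2) xT(4) T'(3)]
      by (auto simp: C_def C'_def)
    ultimately obtain z1 where z1: "bij_betw z1 (T - C) (T' - C')"
      "\<And>y. y \<in> T - C \<Longrightarrow> z1 (- y) = - z1 y \<and> z1 (w y) = w' (z1 y)"
      using less.hyps[of "T - C" "T' - C'"] count' by metis
    define z where "z y = (if y \<in> C then z0 y else z1 y)" for y
    have "bij_betw z (C \<union> (T - C)) (C' \<union> (T' - C'))"
    proof (rule bij_betw_combine)
      show "bij_betw z C C'" using z0(1) by (rule bij_betw_cong[THEN iffD2, rotated]) (simp add: z_def)
      show "bij_betw z (T - C) (T' - C')" using z1(1)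
        by (rule bij_betw_cong[THEN iffD2, rotated]) (simp add: z_def)
    qed auto
    moreover have "C \<union> (T - C) = T" "C' \<union> (T' - C') = T'" using C C' by auto
    moreover have "z (- y) = - z y \<and> z (w y) = w' (z y)" if y: "y \<in> T" for y
    proof (cases "y \<in> C")
      case True
      then have "- y \<in> C" "w y \<in> C" using C by (auto simp: sym_set_def)
      then show ?thesis using True z0(2) by (simp add: z_def)
    next
      case False
      then have "- y \<notin> C" "w y \<notin> C" using y TC(3) sym_set_minus_iff[OF C(2)] by auto
      then show ?thesis using False y z1(2) by (simp add: z_def)
    qed
    ultimately show ?thesis using less.prems(1)[of z] by simp
  qed
qed

lemma conjugate_if_same_type_count:
  assumes S: "sym_set S" and w: "w \<in> odd_perms S" "w' \<in> odd_perms S"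
    and count: "\<And>t. type_count S w t = type_count S w' t"
  obtains z where "z \<in> odd_perms S" "z \<circ> w = w' \<circ> z"
proof -
  have "w ` S \<subseteq> S" "w' ` S \<subseteq> S" using odd_perms_in_iff w by auto
  then obtain z where z: "bij_betw z S S" "\<And>y. y \<in> S \<Longrightarrow> z (- y) = - z y \<and> z (w y) = w' (z y)"
    using conjugator_on[OF S w order_refl S _ order_refl S _ count] by metis
  define z' where "z' y = (if y \<in> S then z y else y)" for y
  have "z' permutes S"
    by (rule bij_imp_permutes) (use z(1) in \<open>auto simp: z'_def cong: bij_betw_cong\<close>)
  moreover have "z' (- y) = - z' y" for y
    using z(2) sym_set_minus_iff[OF S, of y] by (auto simp: z'_def)
  moreover have "(z' \<circ> w) y = (w' \<circ> z') y" for y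
    using z(2)[of y] odd_perms_in_iff[OF w(1), of y] permutes_not_in[OF odd_permsD(1)[OF w(1)], of y]
      permutes_not_in[OF odd_permsD(1)[OF w(2)], of y]
    by (auto simp: z'_def)
  ultimately show ?thesis by (intro that[of z']) (auto simp: odd_perms_def)
qed

lemma trivial_signed_char: "sym_set U \<Longrightarrow> signed_char U (\<lambda>_. 1 :: 'a :: comm_ring_1) 1 1"
  by (rule signed_char.intro) simp_all

lemma type_exists:
  assumes "sym_set S" "\<And>t. t \<in># M \<Longrightarrow> 0 < fst t \<and> snd t \<in> Z2" "card (pos_part S) = (\<Sum>t\<in>#M. fst t)"
  obtains w where "w \<in> odd_perms S" "\<And>t. type_count S w t = fst t * count M t"
  using assms
proof (induction M arbitrary: S thesis)
  case empty
  then have "pos_part S = {}" by (simp add: finite_pos_part)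
  then show ?case by (intro empty(1)[of id]) (simp_all add: type_count_def odd_perms_id[unfolded id_def] id_def)
next
  case (add t M)
  note S = add.prems(2)
  obtain m e where t: "t = (m, e)" "0 < m" "e \<in> Z2" using add.prems(3)[of t] by (cases t) auto
  have "m \<le> card (pos_part S)" using add.prems(4) by (simp add: t)
  then obtain P where P: "P \<subseteq> pos_part S" "card P = m" "finite P" by (rule obtain_subset_with_card_n)
  obtain xs where xs: "set xs = P" "distinct xs" using finite_distinct_list[OF P(3)] by auto
  have len: "length xs = m" using xs P distinct_card by metis
  have xs': "xs \<noteq> []" "set xs \<subseteq> S" "0 \<notin> set xs" using xs P len t by (auto simp: pos_part_def)
  have "\<bar>i\<bar> = i" if "i \<in> set xs" for i using that xs P by (auto simp: pos_part_def)
  then have "inj_on abs (set xs)" by (simp add: inj_on_def)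
  then have dist: "distinct (map abs xs)" using xs by (simp add: distinct_map)
  define C where "C = abs_closure xs"
  \<comment> \<open>Only the cycle itself is wanted, so the trivial character serves.\<close>
  interpret signed_char S "\<lambda>_. 1 :: int" 1 1 by (rule trivial_signed_char[OF S])
  obtain c where c: "c \<in> odd_perms C" "chain_of c xs" "c (last xs) = e * hd xs"
    unfolding C_def using cycle_exists[OF xs'(1) dist xs'(2) t(3)] by metis
  have C: "sym_set C" "C \<subseteq> S" "card (pos_part C) = m" unfolding C_def
    using sym_set_abs_closure abs_closure_subset[OF S] card_pos_part_abs_closure xs' dist len by auto
  have "card (pos_part (S - C)) = (\<Sum>t\<in>#M. fst t)"
    using C S add.prems(4) by (simp add: pos_part_Diff card_Diff_subset finite_pos_part pos_part_mono t)
  then obtain w where w: "w \<in> odd_perms (S - C)" "\<And>t. type_count (S - C) w t = fst t * count M t"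
    using add.IH[of "S - C"] add.prems(3) sym_set_Diff[OF S C(1)] by auto
  note cw = chain_of_comp[OF S xs'(1,2) c[unfolded C_def] w(1)[unfolded C_def]]
  have "type_count S (c \<circ> w) u = fst u * count (add_mset t M) u" for u
  proof -
    have "type_count C (c \<circ> w) u = (if u = t then m else 0)"
      using type_count_const[of C "c \<circ> w" t u] ctype_chain_of[OF S cw(1) xs'(2,1) dist cw(2,3) t(3)] C(3)
      by (simp add: C_def t len)
    moreover have "type_count (S - C) (c \<circ> w) u = type_count (S - C) w u"
      unfolding type_count_def using ctype_comp[OF c(1) w(1)] by (intro arg_cong[of _ _ card]) (auto simp: pos_part_def)
    ultimately show ?thesis using type_count_Diff[OF S C(2)] w(2) by (auto simp: t)
  qed
  then show ?case using add.prems(1) cw(1) by blast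
qed

section \<open>Signed cycles as pairs of orbits\<close>

definition cycle_pair :: "(int \<Rightarrow> int) \<Rightarrow> int \<Rightarrow> int set set" where
  "cycle_pair w x = {orbit w x, uminus ` orbit w x}"

context
  fixes S w
  assumes S: "sym_set S" and w: "w \<in> odd_perms S"
begin

lemma orbit_conv: "orbit w x = {(w ^^ i) x | i. True}"
proof -
  have "permutation w" using odd_permsD(1)[OF w] S by (auto simp: permutation_permutes sym_set_def)
  then show ?thesis by (simp add: orbit_altdef_permutation)
qed

lemma self_in_orbit: "x \<in> orbit w x"
  unfolding orbit_conv by (auto intro: exI[of _ 0])

lemma orbit_uminus: "uminus ` orbit w x = orbit w (- x)"
proof -
  have "(w ^^ i) (- x) = - (w ^^ i) x" for i by (rule odd_permsD(2)[OF odd_perms_funpow[OF w]])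
  then show ?thesis by (auto simp: orbit_conv image_iff)
qed

lemma orbit_step_eq: "orbit w (w x) = orbit w x"
proof -
  have "permutation w" using odd_permsD(1)[OF w] S by (auto simp: permutation_permutes sym_set_def)
  then show ?thesis by (rule permutation_orbit_step)
qed

lemma orbit_funpow_eq: "orbit w ((w ^^ i) x) = orbit w x"
  by (induction i) (simp_all add: orbit_step_eq)

lemma Union_cycle_pair: "\<Union>(cycle_pair w x) = scycle w x"
proof -
  have "z \<in> scycle w x \<longleftrightarrow> (\<exists>i. z = (w ^^ i) x \<or> z = - (w ^^ i) x)" for z
    unfolding scycle_def by (auto simp: Z2_iff) (metis mult_1 mult_minus_left)+
  then show ?thesis unfolding cycle_pair_def orbit_conv by auto
qed

lemma cycle_pair_uminus: "cycle_pair w (- x) = cycle_pair w x"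
  using orbit_uminus[of x] orbit_uminus[of "- x"] by (auto simp: cycle_pair_def)

lemma cycle_pair_eq_iff: "cycle_pair w y = cycle_pair w x \<longleftrightarrow> y \<in> scycle w x"
proof
  assume "cycle_pair w y = cycle_pair w x"
  then show "y \<in> scycle w x" using Union_cycle_pair self_in_scycle by metis
next
  assume "y \<in> scycle w x"
  then obtain d i where y: "d \<in> Z2" "y = d * (w ^^ i) x" by (rule scycleE)
  have "cycle_pair w ((w ^^ i) x) = cycle_pair w x"
    by (simp add: cycle_pair_def orbit_funpow_eq)
  then show "cycle_pair w y = cycle_pair w x"
    using y cycle_pair_uminus by (auto simp: Z2_iff)
qed

text \<open>The absolute values of the first \<open>clen w x\<close> iterates list the positive
  entries once each; a repetition would mean an earlier return to \<plusminus>x.\<close>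

lemma card_pos_part_scycle:
  assumes x: "x \<in> S"
  shows "card (pos_part (scycle w x)) = clen w x"
proof -
  let ?m = "clen w x" and ?h = "\<lambda>i. \<bar>(w ^^ i) x\<bar>"
  have m: "0 < ?m" by (rule clen_pos[OF S w x])
  have shift: "?h i = ?h j \<longleftrightarrow> ?h (j - i) = \<bar>x\<bar>" if "i \<le> j" for i j
  proof -
    have "(w ^^ j) x = (w ^^ i) ((w ^^ (j - i)) x)"
      using that by (metis comp_apply funpow_add le_add_diff_inverse)
    then show ?thesis using odd_perms_abs_eq_iff[OF odd_perms_funpow[OF w, of i]] by (metis (no_types))
  qed
  have "?h i \<noteq> ?h j" if "i < j" "j < ?m" for i j
    using shift[of i j] abs_funpow_less_clen[OF S w x, of "j - i"] that by auto
  then have inj: "inj_on ?h {..<?m}"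
    by (intro linorder_inj_onI') auto
  have "pos_part (scycle w x) = ?h ` {..<?m}"
  proof (rule equalityI; rule subsetI)
    fix y assume "y \<in> pos_part (scycle w x)"
    then obtain d i where y: "d \<in> Z2" "y = d * (w ^^ i) x" "0 < y"
      by (auto simp: pos_part_def scycle_def)
    have "?m dvd i - i mod ?m" by (simp add: minus_mod_eq_mult_div)
    then have "?h (i mod ?m) = ?h i"
      using shift[of "i mod ?m" i] abs_funpow_eq_iff[OF S w x] by simp
    moreover have "y = ?h i" using y by (metis abs_Z2_mult abs_of_pos)
    ultimately show "y \<in> ?h ` {..<?m}" using m by (intro image_eqI[of _ _ "i mod ?m"]) auto
  next
    fix y assume "y \<in> ?h ` {..<?m}"
    then obtain i where i: "y = ?h i" by auto
    have "(w ^^ i) x \<in> S" using odd_perms_in_iff[OF odd_perms_funpow[OF w]] x by blast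
    then have "0 < y" using S i by (auto simp: sym_set_def)
    moreover have "y \<in> scycle w x"
      using scycleI[of 1 i w x] scycleI[of "- 1" i w x] i by (auto simp: Z2_iff abs_if)
    ultimately show "y \<in> pos_part (scycle w x)" by (simp add: pos_part_def)
  qed
  then show ?thesis using card_image[OF inj] by simp
qed

lemma signed_cycle_length_cycle_pair:
  "x \<in> S \<Longrightarrow> signed_cycle_length (cycle_pair w x) = clen w x"
  unfolding signed_cycle_length_def Union_cycle_pair
  by (simp add: card_sym_set[OF sym_set_scycle[OF S w]] card_pos_part_scycle)

text \<open>If -x lies in the orbit, then -1 is a power of \<open>csgn w x\<close>; conversely the
  iterate number \<open>clen w x\<close> reaches -x. This ties \<open>csgn\<close> to the definition
  of the class by comparing c with its negative.\<close>

lemma orbit_selfneg_iff: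
  assumes x: "x \<in> S"
  shows "orbit w x = uminus ` orbit w x \<longleftrightarrow> csgn w x = - 1"
proof
  assume "orbit w x = uminus ` orbit w x"
  then have "- x \<in> orbit w x" using self_in_orbit by blast
  then obtain i where "(w ^^ i) x = - 1 * x" by (auto simp: orbit_conv)
  then have "- 1 = csgn w x ^ (i div clen w x)"
    using funpow_eq_scale_iff[OF S w x, of "- 1" i] by (simp add: Z2_iff)
  then show "csgn w x = - 1" using csgn_Z2[of w x] by (auto simp: Z2_iff)
next
  assume "csgn w x = - 1"
  then have "- x = (w ^^ clen w x) x" by (simp add: funpow_clen[OF S w x])
  then have "orbit w (- x) = orbit w x" using orbit_funpow_eq by simp
  then show "orbit w x = uminus ` orbit w x" by (simp add: orbit_uminus)
qed

text \<open>
  Every signed cycle of length \<open>m\<close> has exactly \<open>m\<close> positive entries.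
\<close>

lemma card_eq_sum_cycle_lengths:
  assumes A: "A \<subseteq> pos_part S" "\<And>x y. x \<in> A \<Longrightarrow> y \<in> pos_part S \<Longrightarrow> ctype w y = ctype w x \<Longrightarrow> y \<in> A"
  shows "card A = (\<Sum>C\<in>cycle_pair w ` A. signed_cycle_length C)"
proof -
  have fin: "finite A" using A finite_pos_part[OF S] finite_subset by blast
  have "card A = (\<Sum>C\<in>cycle_pair w ` A. card {x \<in> A. cycle_pair w x = C})"
    using sum.group[OF fin finite_imageI[OF fin] order_refl, where g = "cycle_pair w" and h = "\<lambda>_. 1 :: nat"] by simp
  also have "\<dots> = (\<Sum>C\<in>cycle_pair w ` A. signed_cycle_length C)"
  proof (rule sum.cong[OF refl])
    fix C assume "C \<in> cycle_pair w ` A"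
    then obtain x where x: "x \<in> A" "C = cycle_pair w x" by auto
    then have xS: "x \<in> S" using A by (auto simp: pos_part_def)
    have "{y \<in> A. cycle_pair w y = C} = pos_part (scycle w x)"
    proof (rule equalityI; rule subsetI)
      fix y assume "y \<in> {y \<in> A. cycle_pair w y = C}"
      then show "y \<in> pos_part (scycle w x)"
        using A x by (auto simp: cycle_pair_eq_iff pos_part_def)
    next
      fix y assume y: "y \<in> pos_part (scycle w x)"
      then have "y \<in> scycle w x" "y \<in> pos_part S"
        using scycle_subset_S[OF S w xS] by (auto simp: pos_part_def)
      then show "y \<in> {y \<in> A. cycle_pair w y = C}"
        using A(2)[OF x(1)] ctype_scycle[OF S w xS] x(2) cycle_pair_eq_iff by auto
    qed
    then show "card {y \<in> A. cycle_pair w y = C} = signed_cycle_length C"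
      using x(2) xS by (simp add: card_pos_part_scycle signed_cycle_length_cycle_pair)
  qed
  finally show ?thesis .
qed

end

lemma count_image_mset_set:
  assumes "finite A"
  shows "count (image_mset h (mset_set A)) j = card {x \<in> A. h x = j}"
proof -
  have "h -` {j} \<inter> A = {x \<in> A. h x = j}" by auto
  then show ?thesis using assms by (simp add: count_image_mset)
qed

context
  fixes n w
  assumes w: "w \<in> odd_perms (signed_points n)"
begin

lemma signed_cycles_conv:
  assumes "\<theta> \<in> Z2"
  shows "signed_cycles n w \<theta> = cycle_pair w ` {x \<in> pos_part (signed_points n). csgn w x = \<theta>}"
proof -
  have "signed_cycles n w \<theta> = cycle_pair w ` {x \<in> signed_points n. csgn w x = \<theta>}"
  proof -
    have "(if \<theta> = 1 then orbit w x \<noteq> uminus ` orbit w x else orbit w x = uminus ` orbit w x) \<longleftrightarrow> csgn w x = \<theta>"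
      if "x \<in> signed_points n" for x
      using orbit_selfneg_iff[OF sym_set_signed_points w that] assms csgn_Z2[of w x] by (auto simp: Z2_iff)
    then show ?thesis
      unfolding signed_cycles_def cycles_def cycle_pair_def by blast
  qed
  also have "\<dots> = cycle_pair w ` {x \<in> pos_part (signed_points n). csgn w x = \<theta>}"
  proof (rule equalityI; rule subsetI)
    fix C assume "C \<in> cycle_pair w ` {x \<in> signed_points n. csgn w x = \<theta>}"
    then obtain x where x: "x \<in> signed_points n" "csgn w x = \<theta>" "C = cycle_pair w x" by auto
    have "csgn w \<bar>x\<bar> = csgn w x" using ctype_uminus[OF sym_set_signed_points w x(1)] by (simp add: abs_if ctype_def)
    moreover have "\<bar>x\<bar> \<in> pos_part (signed_points n)"
      using x(1) by (auto simp: pos_part_def signed_points_def)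
    moreover have "C = cycle_pair w \<bar>x\<bar>"
      using x(3) cycle_pair_uminus[OF sym_set_signed_points w] by (simp add: abs_if)
    ultimately show "C \<in> cycle_pair w ` {x \<in> pos_part (signed_points n). csgn w x = \<theta>}"
      using x(2) by blast
  qed (auto simp: pos_part_def)
  finally show ?thesis .
qed

lemma finite_signed_cycles: "\<theta> \<in> Z2 \<Longrightarrow> finite (signed_cycles n w \<theta>)"
  by (simp add: signed_cycles_conv finite_pos_part[OF sym_set_signed_points])

lemma component_cycle_type:
  "\<theta> \<in> Z2 \<Longrightarrow> component (cycle_type n w) \<theta> = image_mset signed_cycle_length (mset_set (signed_cycles n w \<theta>))"
  by (auto simp: component_def cycle_type_def Z2_iff)

lemma type_count_eq_parts_of:
  assumes "\<theta> \<in> Z2"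
  shows "type_count (signed_points n) w (j, \<theta>) = j * parts_of (cycle_type n w) j \<theta>"
proof -
  let ?S = "signed_points n"
  define A where "A = {x \<in> pos_part ?S. ctype w x = (j, \<theta>)}"
  have len: "signed_cycle_length (cycle_pair w x) = clen w x" if "x \<in> pos_part ?S" for x
    using that signed_cycle_length_cycle_pair[OF sym_set_signed_points w] by (auto simp: pos_part_def)
  have "{C \<in> signed_cycles n w \<theta>. signed_cycle_length C = j} = cycle_pair w ` A"
    unfolding signed_cycles_conv[OF assms] A_def using len by (auto simp: ctype_def)
  then have "parts_of (cycle_type n w) j \<theta> = card (cycle_pair w ` A)"
    using finite_signed_cycles[OF assms]
    by (simp add: parts_of_def component_cycle_type[OF assms] count_image_mset_set)
  moreover have "card A = (\<Sum>C\<in>cycle_pair w ` A. signed_cycle_length C)"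
    by (rule card_eq_sum_cycle_lengths[OF sym_set_signed_points w]) (auto simp: A_def)
  moreover have "(\<Sum>C\<in>cycle_pair w ` A. signed_cycle_length C) = (\<Sum>C\<in>cycle_pair w ` A. j)"
    by (rule sum.cong) (auto simp: A_def len ctype_def)
  ultimately show ?thesis by (simp add: type_count_def A_def)
qed

lemma cycle_type_in_bipartitions: "cycle_type n w \<in> bipartitions n"
proof -
  let ?S = "signed_points n"
  define A where "A \<theta> = {x \<in> pos_part ?S. csgn w x = \<theta>}" for \<theta>
  have "sum_mset (component (cycle_type n w) \<theta>) = card (A \<theta>)" if "\<theta> \<in> Z2" for \<theta>
  proof -
    have "card (A \<theta>) = (\<Sum>C\<in>cycle_pair w ` A \<theta>. signed_cycle_length C)"
      by (rule card_eq_sum_cycle_lengths[OF sym_set_signed_points w]) (auto simp: A_def ctype_def)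
    then show ?thesis
      using that by (simp add: component_cycle_type signed_cycles_conv A_def sum_unfold_sum_mset)
  qed
  moreover have "card (A 1) + card (A (- 1)) = n"
  proof -
    have "card (A 1) + card (A (- 1)) = card (A 1 \<union> A (- 1))"
      by (rule card_Un_disjoint[symmetric]) (auto simp: A_def finite_pos_part[OF sym_set_signed_points])
    also have "A 1 \<union> A (- 1) = {1..int n}"
      using csgn_Z2[of w] by (auto simp: A_def Z2_iff simp flip: pos_part_signed_points)
    finally show ?thesis by simp
  qed
  moreover have "0 \<notin># component (cycle_type n w) \<theta>" if \<theta>: "\<theta> \<in> Z2" for \<theta>
  proof
    assume "0 \<in># component (cycle_type n w) \<theta>"
    then obtain x where "x \<in> signed_points n" "clen w x = 0"
      using \<theta> finite_signed_cycles[OF \<theta>]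
      by (auto simp: component_cycle_type signed_cycles_conv signed_cycle_length_cycle_pair[OF sym_set_signed_points w] pos_part_def)
    then show False using clen_pos[OF sym_set_signed_points w] by force
  qed
  ultimately show ?thesis
    by (force simp: bipartitions_def component_def Z2_iff case_prod_unfold)
qed

text \<open>Sort the positive points by class and then by length: each group has j times as many
  points as there are parts j, which is the exponent in \<open>t_monom\<close>.\<close>

lemma t_monom_cycle_type:
  "t_monom (cycle_type n w) = (\<Prod>i\<in>pos_part (signed_points n). mps_var (ctype w i))"
proof -
  let ?S = "signed_points n"
  have fin: "finite (pos_part ?S)" by (rule finite_pos_part[OF sym_set_signed_points])
  have "(\<Prod>i\<in>pos_part ?S. mps_var (ctype w i))
      = (\<Prod>\<theta>\<in>Z2. \<Prod>i\<in>{i \<in> pos_part ?S. csgn w i = \<theta>}. mps_var (ctype w i) :: series)"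
    by (rule prod.group[symmetric]) (use fin csgn_Z2 in \<open>auto simp: Z2_def\<close>)
  also have "\<dots> = t_monom (cycle_type n w)"
    unfolding t_monom_def
  proof (rule prod.cong[OF refl])
    fix \<theta> assume \<theta>: "\<theta> \<in> Z2"
    let ?A = "{i \<in> pos_part ?S. csgn w i = \<theta>}" and ?J = "set_mset (component (cycle_type n w) \<theta>)"
    have "clen w i \<in> ?J" if "i \<in> ?A" for i
    proof -
      have "0 < type_count ?S w (clen w i, \<theta>)"
        unfolding type_count_def card_gt_0_iff using that fin by (auto simp: ctype_def)
      then show ?thesis by (auto simp: type_count_eq_parts_of[OF \<theta>] parts_of_def)
    qed
    then have "(\<Prod>i\<in>?A. mps_var (ctype w i))
        = (\<Prod>j\<in>?J. \<Prod>i\<in>{i \<in> ?A. clen w i = j}. mps_var (ctype w i) :: series)"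
      by (intro prod.group[symmetric]) (use fin in auto)
    also have "\<dots> = (\<Prod>j\<in>?J. t_var j \<theta> ^ (j * parts_of (cycle_type n w) j \<theta>))"
    proof (rule prod.cong[OF refl])
      fix j
      have *: "{i \<in> ?A. clen w i = j} = {i \<in> pos_part ?S. ctype w i = (j, \<theta>)}"
        by (auto simp: ctype_def)
      show "(\<Prod>i\<in>{i \<in> ?A. clen w i = j}. mps_var (ctype w i)) = t_var j \<theta> ^ (j * parts_of (cycle_type n w) j \<theta>)"
        unfolding * type_count_eq_parts_of[OF \<theta>, symmetric] type_count_def by simp
    qed
    finally show "(\<Prod>i\<in>?A. mps_var (ctype w i)) = (\<Prod>j\<in>?J. t_var j \<theta> ^ (j * parts_of (cycle_type n w) j \<theta>))" .
  qed
  finally show ?thesis ..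
qed

lemma cycle_type_eqI:
  assumes "\<mu> \<in> bipartitions n" "\<And>j \<theta>. \<theta> \<in> Z2 \<Longrightarrow> type_count (signed_points n) w (j, \<theta>) = j * parts_of \<mu> j \<theta>"
  shows "cycle_type n w = \<mu>"
proof -
  have "parts_of (cycle_type n w) j \<theta> = parts_of \<mu> j \<theta>" if "\<theta> \<in> Z2" for j \<theta>
  proof (cases "j = 0")
    \<comment> \<open>At j = 0 the factor j hides the multiplicities; both vanish because a
      bipartition has no part 0.\<close>
    case True
    have "parts_of \<nu> 0 \<theta> = 0" if "\<nu> \<in> bipartitions n" for \<nu>
      using that by (auto simp: bipartitions_def parts_of_def component_def count_eq_zero_iff)
    then show ?thesis using True assms(1) cycle_type_in_bipartitions by simp
  next
    case False
    then show ?thesis using assms(2)[OF that, of j] type_count_eq_parts_of[OF that, of j] by simp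
  qed
  from this[of 1] this[of "- 1"] show ?thesis
    by (auto simp: parts_of_def component_def Z2_iff prod_eq_iff intro: multiset_eqI)
qed

end

lemma cycle_type_eq_iff:
  assumes "w \<in> odd_perms (signed_points n)" "w' \<in> odd_perms (signed_points n)"
  shows "cycle_type n w = cycle_type n w'
    \<longleftrightarrow> (\<forall>t. type_count (signed_points n) w t = type_count (signed_points n) w' t)"
proof
  assume eq: "cycle_type n w = cycle_type n w'"
  show "\<forall>t. type_count (signed_points n) w t = type_count (signed_points n) w' t"
  proof
    fix t :: "nat \<times> int"
    show "type_count (signed_points n) w t = type_count (signed_points n) w' t"
    proof (cases "snd t \<in> Z2")
      case True
      then show ?thesis
        using type_count_eq_parts_of[OF assms(1) True] type_count_eq_parts_of[OF assms(2) True] eq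
        by (metis prod.collapse)
    next
      case False
      then have "{i \<in> pos_part (signed_points n). ctype w i = t} = {}" for w
        using csgn_Z2 by (auto simp: ctype_def)
      then have "type_count (signed_points n) w t = 0" for w
        by (simp only: type_count_def card.empty)
      then show ?thesis by simp
    qed
  qed
next
  assume "\<forall>t. type_count (signed_points n) w t = type_count (signed_points n) w' t"
  then show "cycle_type n w = cycle_type n w'"
    by (intro cycle_type_eqI[OF assms(1)] cycle_type_in_bipartitions[OF assms(2)])
      (simp add: type_count_eq_parts_of[OF assms(2)])
qed

text \<open>By \<open>type_exists\<close> every bipartition of n is a cycle type, so here the choice
  in \<open>class_rep\<close> never falls back on an arbitrary value.\<close>

lemma class_rep:
  assumes "\<mu> \<in> bipartitions n"
  shows "class_rep n \<mu> \<in> odd_perms (signed_points n)" "cycle_type n (class_rep n \<mu>) = \<mu>"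
proof -
  obtain p q where \<mu>: "\<mu> = (p, q)" "0 \<notin># p" "0 \<notin># q" "sum_mset p + sum_mset q = n"
    using assms by (auto simp: bipartitions_def)
  define M where "M = image_mset (\<lambda>j. (j, 1 :: int)) p + image_mset (\<lambda>j. (j, - 1)) q"
  have count_Pair: "count (image_mset (\<lambda>j. (j, b)) p) (j, a) = (if a = b then count p j else 0)"
    for p :: "nat multiset" and j and a b :: int
    by (induction p) auto
  obtain w where w: "w \<in> odd_perms (signed_points n)" "\<And>t. type_count (signed_points n) w t = fst t * count M t"
  proof (rule type_exists[OF sym_set_signed_points[of n], of M])
    show "0 < fst t \<and> snd t \<in> Z2" if "t \<in># M" for t
      using that \<mu> by (auto simp: M_def Z2_iff intro: gr0I)
    show "card (pos_part (signed_points n)) = (\<Sum>t\<in>#M. fst t)"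
      using \<mu> by (simp add: pos_part_signed_points M_def multiset.map_comp comp_def)
  qed blast
  have "cycle_type n w = \<mu>"
    by (rule cycle_type_eqI[OF w(1) assms])
      (auto simp: w(2) M_def count_Pair parts_of_def component_def \<mu> Z2_iff)
  with w(1) have "\<exists>w. w \<in> carrier (hyperoctahedral n) \<and> cycle_type n w = \<mu>"
    by (auto simp: carrier_hyperoctahedral)
  from someI_ex[OF this] show "class_rep n \<mu> \<in> odd_perms (signed_points n)" "cycle_type n (class_rep n \<mu>) = \<mu>"
    by (simp_all add: class_rep_def carrier_hyperoctahedral)
qed

section \<open>Characters and class sums\<close>

lemma hyperoctahedral_pow: "x [^]\<^bsub>hyperoctahedral n\<^esub> k = x ^^ k"
proof -
  interpret group "hyperoctahedral n" by (rule group_hyperoctahedral)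
  show ?thesis
  proof (induction k)
    case 0
    show ?case by (simp add: hyperoctahedral_def id_def)
  next
    case (Suc k)
    have "x [^]\<^bsub>hyperoctahedral n\<^esub> Suc k = x [^]\<^bsub>hyperoctahedral n\<^esub> k \<circ> x"
      by (simp add: hyperoctahedral_def)
    then show ?case unfolding Suc by (simp add: funpow_Suc_right del: funpow.simps)
  qed
qed

lemma abs_perm_permutes:
  assumes "w \<in> odd_perms (signed_points n)"
  shows "abs_perm n w permutes {1..int n}"
proof (rule bij_imp_permutes)
  have "\<bar>w i\<bar> \<in> {1..int n}" if "i \<in> {1..int n}" for i
    using odd_perms_in_iff[OF assms, of i] that by (auto simp: signed_points_def)
  moreover have "inj_on (\<lambda>i. \<bar>w i\<bar>) {1..int n}"
    by (auto simp: inj_on_def odd_perms_abs_eq_iff[OF assms])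
  ultimately have "bij_betw (\<lambda>i. \<bar>w i\<bar>) {1..int n} {1..int n}"
    unfolding bij_betw_def by (intro conjI endo_inj_surj) auto
  then show "bij_betw (abs_perm n w) {1..int n} {1..int n}"
    by (rule bij_betw_cong[THEN iffD2, rotated]) (simp add: abs_perm_def)
qed (auto simp: abs_perm_def)

lemma permutation_abs_perm: "w \<in> odd_perms (signed_points n) \<Longrightarrow> permutation (abs_perm n w)"
  using abs_perm_permutes by (auto simp: permutation_permutes)

lemma abs_perm_comp:
  assumes "w \<in> odd_perms (signed_points n)" "w' \<in> odd_perms (signed_points n)"
  shows "abs_perm n (w \<circ> w') = abs_perm n w \<circ> abs_perm n w'"
proof
  fix i
  show "abs_perm n (w \<circ> w') i = (abs_perm n w \<circ> abs_perm n w') i"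
  proof (cases "i \<in> {1..int n}")
    case True
    then have "\<bar>w' i\<bar> \<in> {1..int n}"
      using odd_perms_in_iff[OF assms(2), of i] by (auto simp: signed_points_def)
    moreover have "\<bar>w (w' i)\<bar> = \<bar>w \<bar>w' i\<bar>\<bar>" by (simp add: odd_perms_abs_eq_iff[OF assms(1)])
    ultimately show ?thesis using True by (simp add: abs_perm_def)
  qed (auto simp: abs_perm_def)
qed

lemma chi'_comp:
  "w \<in> odd_perms (signed_points n) \<Longrightarrow> w' \<in> odd_perms (signed_points n) \<Longrightarrow> chi' n (w \<circ> w') = chi' n w * chi' n w'"
  unfolding chi'_def by (simp add: abs_perm_comp sign_compose permutation_abs_perm)

text \<open>Since \<open>w\<close> is odd, the sign of \<open>w (w' i)\<close> is the sign of
  \<open>w\<close> at \<open>\<bar>w' i\<bar>\<close> times the sign of \<open>w' i\<close>; and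
  \<open>\<bar>w' i\<bar>\<close> runs through 1..n along with i.\<close>

lemma chi_comp:
  assumes "w \<in> odd_perms (signed_points n)" "w' \<in> odd_perms (signed_points n)"
  shows "chi n (w \<circ> w') = chi n w * chi n w'"
proof -
  have "sgn (w (w' i)) = sgn (w (abs_perm n w' i)) * sgn (w' i)" if "i \<in> {1..int n}" for i
  proof -
    have "w' i = sgn (w' i) * \<bar>w' i\<bar>" by (simp add: mult_sgn_abs)
    moreover have "w' i \<noteq> 0"
      using odd_perms_in_iff[OF assms(2), of i] that by (auto simp: signed_points_def)
    then have "sgn (w' i) \<in> Z2" by (simp add: Z2_iff sgn_if)
    ultimately have "w (w' i) = sgn (w' i) * w \<bar>w' i\<bar>"
      using odd_perms_scale[OF assms(1)] by metis
    then show ?thesis using that by (simp add: abs_perm_def sgn_mult)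
  qed
  then have "chi n (w \<circ> w') = (\<Prod>i\<in>{1..int n}. sgn (w (abs_perm n w' i))) * chi n w'"
    by (simp add: chi_def prod.distrib)
  also have "(\<Prod>i\<in>{1..int n}. sgn (w (abs_perm n w' i))) = chi n w"
    unfolding chi_def using prod.permute[OF abs_perm_permutes[OF assms(2)], of "\<lambda>i. sgn (w i)"]
    by (simp add: comp_def)
  finally show ?thesis .
qed

lemma signed_points_abs: "x \<in> signed_points n \<Longrightarrow> \<bar>x\<bar> \<in> {1..int n}"
  by (auto simp: signed_points_def)

lemma swap_pair_abs:
  assumes "x \<noteq> 0" "y \<noteq> 0" "\<bar>x\<bar> \<noteq> \<bar>y\<bar>"
  shows "swap_pair x y \<bar>x\<bar> = sgn x * y" "swap_pair x y \<bar>y\<bar> = sgn y * x"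
    "\<bar>i\<bar> \<noteq> \<bar>x\<bar> \<Longrightarrow> \<bar>i\<bar> \<noteq> \<bar>y\<bar> \<Longrightarrow> swap_pair x y i = i"
proof -
  have neq: "x \<noteq> y" "x \<noteq> - y" "y \<noteq> - x" "x \<noteq> - x" "y \<noteq> - y" "- x \<noteq> - y" "- x \<noteq> y" "- y \<noteq> x"
    using assms by auto
  have val: "swap_pair x y x = y" "swap_pair x y (- x) = - y" "swap_pair x y y = x" "swap_pair x y (- y) = - x"
    unfolding swap_pair_def transpose_def using neq neq[symmetric] by simp_all
  show "swap_pair x y \<bar>x\<bar> = sgn x * y" "swap_pair x y \<bar>y\<bar> = sgn y * x"
    using assms(1,2) by (simp_all add: abs_if sgn_if val)
  assume "\<bar>i\<bar> \<noteq> \<bar>x\<bar>" "\<bar>i\<bar> \<noteq> \<bar>y\<bar>"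
  then have "i \<noteq> x" "i \<noteq> - x" "i \<noteq> y" "i \<noteq> - y" by auto
  then show "swap_pair x y i = i" by (simp add: swap_pair_def transpose_def)
qed

lemma abs_perm_swap_pair:
  assumes "x \<in> signed_points n" "y \<in> signed_points n" "\<bar>x\<bar> \<noteq> \<bar>y\<bar>"
  shows "abs_perm n (swap_pair x y) = transpose \<bar>x\<bar> \<bar>y\<bar>"
proof
  fix i
  have xy: "x \<noteq> 0" "y \<noteq> 0" using assms by (auto simp: signed_points_def)
  note xy_in = signed_points_abs[OF assms(1)] signed_points_abs[OF assms(2)]
  consider "i = \<bar>x\<bar>" | "i = \<bar>y\<bar>" | "i \<noteq> \<bar>x\<bar>" "i \<noteq> \<bar>y\<bar>" by blast
  then show "abs_perm n (swap_pair x y) i = transpose \<bar>x\<bar> \<bar>y\<bar> i"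
  proof cases
    case 3
    then have "swap_pair x y i = i" if "0 < i"
      using that by (intro swap_pair_abs(3)[OF xy assms(3)]) auto
    then show ?thesis using 3 by (auto simp: abs_perm_def)
  qed (use xy_in xy in \<open>simp_all add: abs_perm_def swap_pair_abs[OF xy assms(3)] abs_mult\<close>)
qed

lemma abs_perm_flip:
  assumes "x \<in> signed_points n"
  shows "abs_perm n (transpose x (- x)) = id"
  by (rule ext) (auto simp: abs_perm_def transpose_def)

text \<open>The factors at the two moved positions both equal \<open>sgn x * sgn y\<close>, so their
  product is a square.\<close>

lemma chi_swap_pair:
  assumes "x \<in> signed_points n" "y \<in> signed_points n" "\<bar>x\<bar> \<noteq> \<bar>y\<bar>"
  shows "chi n (swap_pair x y) = 1"
proof -
  have xy: "\<bar>x\<bar> \<in> {1..int n}" "\<bar>y\<bar> \<in> {1..int n}" "x \<noteq> 0" "y \<noteq> 0"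
    using assms signed_points_abs by (auto simp: signed_points_def)
  have "chi n (swap_pair x y) = (\<Prod>i\<in>{\<bar>x\<bar>, \<bar>y\<bar>}. sgn (swap_pair x y i))"
    unfolding chi_def
    by (rule prod.mono_neutral_right) (use xy in \<open>auto simp: swap_pair_abs(3)[OF xy(3,4) assms(3)]\<close>)
  also have "\<dots> = 1"
    using assms(3) by (simp add: swap_pair_abs(1,2)[OF xy(3,4) assms(3)] sgn_mult)
      (use xy(3,4) in \<open>simp add: sgn_if\<close>)
  finally show ?thesis .
qed

lemma chi_flip:
  assumes "x \<in> signed_points n"
  shows "chi n (transpose x (- x)) = - 1"
proof -
  have x: "\<bar>x\<bar> \<in> {1..int n}" using assms signed_points_abs by auto
  have "chi n (transpose x (- x)) = (\<Prod>i\<in>{\<bar>x\<bar>}. sgn (transpose x (- x) i))"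
    unfolding chi_def
    by (rule prod.mono_neutral_right) (use x in \<open>auto simp: transpose_def\<close>)
  also have "\<dots> = - 1"
    using x by (cases "x > 0") (auto simp: transpose_def sgn_if)
  finally show ?thesis .
qed

lemma chi_id: "chi n id = 1"
  by (auto simp: chi_def intro!: prod.neutral)

lemma chi'_id: "chi' n id = 1"
proof -
  have "abs_perm n id = id" by (auto simp: abs_perm_def)
  then show ?thesis by (simp add: chi'_def)
qed

lemma chi'_swap_pair:
  "x \<in> signed_points n \<Longrightarrow> y \<in> signed_points n \<Longrightarrow> \<bar>x\<bar> \<noteq> \<bar>y\<bar> \<Longrightarrow> chi' n (swap_pair x y) = - 1"
  by (simp add: chi'_def abs_perm_swap_pair sign_swap_id)

lemma chi'_flip: "x \<in> signed_points n \<Longrightarrow> chi' n (transpose x (- x)) = 1"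
  by (simp add: chi'_def abs_perm_flip)

lemma signed_char_chi': "signed_char (signed_points n) (chi' n) (- 1) 1"
  by unfold_locales
    (simp_all add: sym_set_signed_points chi'_id chi'_comp chi'_swap_pair chi'_flip)

lemma signed_char_chi: "signed_char (signed_points n) (chi n) 1 (- 1)"
  by unfold_locales
    (simp_all add: sym_set_signed_points chi_id chi_comp chi_swap_pair chi_flip)

lemma signed_char_mult:
  assumes "signed_char U g r s" "signed_char U g' r' s'"
  shows "signed_char U (\<lambda>w. g w * g' w) (r * r') (s * s')"
proof -
  interpret g: signed_char U g r s by fact
  interpret g': signed_char U g' r' s' by fact
  show ?thesis
    by unfold_locales (simp_all add: g.sym_U g.g_id g'.g_id g.g_comp g'.g_comp
      g.g_swap g'.g_swap g.g_flip g'.g_flip mult_ac)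
qed

lemma signed_char_of_int:
  assumes "signed_char U g r s"
  shows "signed_char U (\<lambda>w. of_int (g w)) (of_int r) (of_int s)"
proof -
  interpret g: signed_char U g r s by fact
  show ?thesis
    by unfold_locales (simp_all add: g.sym_U g.g_id g.g_comp g.g_swap g.g_flip)
qed

section \<open>Conjugation invariance and orbit counting\<close>

lemma (in signed_char) g_conj:
  assumes "z \<in> odd_perms U" "w \<in> odd_perms U"
  shows "g (z \<circ> w \<circ> Hilbert_Choice.inv z) = g w"
proof -
  have z': "Hilbert_Choice.inv z \<in> odd_perms U" using assms(1) by (rule odd_perms_inv)
  have "g z * g (Hilbert_Choice.inv z) = g (z \<circ> Hilbert_Choice.inv z)"
    using assms z' by (simp add: g_comp)
  also have "\<dots> = 1" using permutes_inv_o(1)[OF odd_permsD(1)[OF assms(1)]] g_id by simp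
  finally have "g z * g (Hilbert_Choice.inv z) = 1" .
  moreover have "g (z \<circ> w \<circ> Hilbert_Choice.inv z) = g z * g w * g (Hilbert_Choice.inv z)"
    using assms z' by (simp add: g_comp odd_perms_comp)
  ultimately show ?thesis by (simp add: ac_simps)
qed

lemma card_odd_perms:
  assumes "sym_set S" "card (pos_part S) = n"
  shows "card (odd_perms S) = 2 ^ n * fact n"
proof -
  interpret signed_char S "\<lambda>_. 1 :: int" 1 1 by (rule trivial_signed_char[OF assms(1)])
  interpret weighted_signed_char S "\<lambda>_. 1 :: int" 1 1 "\<lambda>_. 1" ..
  \<comment> \<open>With all weights 1 every \<open>cycle_weight\<close> is 1, and the constant 1
    solves the recursion 2 n = 2 + ... + 2.\<close>
  have "(\<Sum>w\<in>odd_perms S. weight S w) = of_nat (2 ^ n * fact n) * (\<lambda>_. 1) n"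
    by (rule sum_weight) (use assms in \<open>simp_all add: cycle_weight_def\<close>)
  then have "int (card (odd_perms S)) = int (2 ^ n * fact n)" by (simp add: weight_def)
  then show ?thesis by (simp only: of_nat_eq_iff)
qed

text \<open>
  \<open>z \<circ> w \<circ> inv z\<close> acts on \<open>z x\<close> as \<open>w\<close> acts on \<open>x\<close>.
\<close>

lemma type_count_conj:
  assumes z: "z \<in> odd_perms (signed_points n)" and w: "w \<in> odd_perms (signed_points n)"
  shows "type_count (signed_points n) (z \<circ> w \<circ> Hilbert_Choice.inv z) t = type_count (signed_points n) w t"
proof -
  let ?S = "signed_points n" and ?w = "z \<circ> w \<circ> Hilbert_Choice.inv z"
  have S: "sym_set ?S" by (rule sym_set_signed_points)
  have w': "?w \<in> odd_perms ?S" using z w by (intro odd_perms_comp odd_perms_inv)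
  have inv: "Hilbert_Choice.inv z (z i) = i" for i
    using permutes_inverses(2)[OF odd_permsD(1)[OF z]] .
  have pow: "(?w ^^ i) (z x) = z ((w ^^ i) x)" for i x
    by (induction i) (simp_all add: inv)
  have "ctype ?w (z x) = ctype w x" for x
  proof -
    have "z x = z y \<longleftrightarrow> x = y" for x y using inj_eq[OF odd_permsD(3)[OF z]] .
    then show ?thesis
      unfolding ctype_def clen_def csgn_def pow by (simp add: odd_perms_abs_eq_iff[OF z])
  qed
  \<comment> \<open>\<open>z\<close> may send positive points to negative ones. Types do not change
    under negation, so \<open>abs_perm n z\<close>, which permutes the positive points, can replace
    it.\<close>
  moreover have "ctype ?w \<bar>z x\<bar> = ctype ?w (z x)" if "x \<in> ?S" for x
    using ctype_uminus[OF S w', of "z x"] odd_perms_in_iff[OF z, of x] that by (simp add: abs_if)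
  ultimately have ct: "ctype ?w (abs_perm n z x) = ctype w x" if "x \<in> pos_part ?S" for x
    using that unfolding pos_part_signed_points by (auto simp: abs_perm_def signed_points_def)
  have perm: "abs_perm n z permutes pos_part ?S"
    unfolding pos_part_signed_points using z by (rule abs_perm_permutes)
  have "{i \<in> pos_part ?S. ctype ?w i = t} = abs_perm n z ` {i \<in> pos_part ?S. ctype w i = t}"
  proof (rule equalityI; rule subsetI)
    fix i assume i: "i \<in> {i \<in> pos_part ?S. ctype ?w i = t}"
    then obtain j where "j \<in> pos_part ?S" "i = abs_perm n z j"
      using permutes_image[OF perm] by blast
    then show "i \<in> abs_perm n z ` {i \<in> pos_part ?S. ctype w i = t}"
      using i ct by auto
  qed (use ct permutes_in_image[OF perm] in auto)
  then show ?thesis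
    unfolding type_count_def using permutes_inj_on[OF perm] by (simp add: card_image)
qed

text \<open>
  Orbit counting for the conjugation action: each element of the class is \<open>z \<circ> w \<circ> inv z\<close> for
  exactly \<open>card (centralizer n w)\<close> many \<open>z\<close>.
\<close>

lemma sum_class:
  fixes F :: "(int \<Rightarrow> int) \<Rightarrow> int"
  assumes w: "w \<in> odd_perms (signed_points n)"
    and F: "\<And>z. z \<in> odd_perms (signed_points n) \<Longrightarrow> F (z \<circ> w \<circ> Hilbert_Choice.inv z) = F w"
  shows "int (card (centralizer n w)) * (\<Sum>y | y \<in> odd_perms (signed_points n) \<and> cycle_type n y = cycle_type n w. F y)
    = int (card (odd_perms (signed_points n))) * F w"
proof -
  let ?B = "odd_perms (signed_points n)"
  let ?K = "{y \<in> ?B. cycle_type n y = cycle_type n w}"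
  let ?c = "\<lambda>z. z \<circ> w \<circ> Hilbert_Choice.inv z"
  have S: "sym_set (signed_points n)" by (rule sym_set_signed_points)
  have fin: "finite ?B" using S by (simp add: sym_set_def finite_odd_perms)
  have inv1: "z \<circ> Hilbert_Choice.inv z = id" "Hilbert_Choice.inv z \<circ> z = id" if "z \<in> ?B" for z
    using permutes_inv_o[OF odd_permsD(1)[OF that]] .
  have cB: "?c z \<in> ?B" if "z \<in> ?B" for z using that w by (intro odd_perms_comp odd_perms_inv)
  have c_iff: "?c z = y \<longleftrightarrow> z \<circ> w = y \<circ> z" if "z \<in> ?B" for z y
  proof -
    have inv: "Hilbert_Choice.inv z (z i) = i" "z (Hilbert_Choice.inv z i) = i" for i
      using permutes_inverses[OF odd_permsD(1)[OF that]] by auto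
    show ?thesis
    proof
      assume "?c z = y"
      then have "z (w (Hilbert_Choice.inv z i)) = y i" for i by (simp add: fun_eq_iff)
      then have "z (w i) = y (z i)" for i by (metis inv(1))
      then show "z \<circ> w = y \<circ> z" by (simp add: fun_eq_iff)
    next
      assume "z \<circ> w = y \<circ> z"
      then have "z (w i) = y (z i)" for i by (simp add: fun_eq_iff)
      then show "?c z = y" by (simp add: fun_eq_iff inv)
    qed
  qed
  have cK: "?c z \<in> ?K" if "z \<in> ?B" for z
    using cB[OF that] type_count_conj[OF that w] by (simp add: cycle_type_eq_iff[OF cB[OF that] w])
  have cent: "centralizer n w = {z \<in> ?B. z \<circ> w = w \<circ> z}"
    unfolding centralizer_def carrier_hyperoctahedral by (simp add: hyperoctahedral_def)
  have fiber: "card {z \<in> ?B. ?c z = y} = card (centralizer n w)" if y: "y \<in> ?K" for y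
  proof -
    have y': "y \<in> ?B" "cycle_type n w = cycle_type n y" using y by auto
    have "type_count (signed_points n) w t = type_count (signed_points n) y t" for t
      using iffD1[OF cycle_type_eq_iff[OF w y'(1)] y'(2)] by (rule spec)
    then obtain z0 where z0: "z0 \<in> ?B" "z0 \<circ> w = y \<circ> z0"
      by (rule conjugate_if_same_type_count[OF S w y'(1)])
    then have zw: "z0 (w i) = y (z0 i)" for i by (simp add: fun_eq_iff)
    \<comment> \<open>The elements that conjugate \<open>w\<close> to \<open>y\<close> form the
      coset of the centralizer through \<open>z0\<close>.\<close>
    have bij: "bij_betw (\<lambda>z. z0 \<circ> z) (centralizer n w) {z \<in> ?B. z \<circ> w = y \<circ> z}"
    proof (rule bij_betw_byWitness[where f' = "\<lambda>z. Hilbert_Choice.inv z0 \<circ> z"])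
      show "\<forall>z\<in>centralizer n w. Hilbert_Choice.inv z0 \<circ> (z0 \<circ> z) = z"
        "\<forall>z\<in>{z \<in> ?B. z \<circ> w = y \<circ> z}. z0 \<circ> (Hilbert_Choice.inv z0 \<circ> z) = z"
        using inv1[OF z0(1)] by (simp_all flip: comp_assoc)
      show "(\<lambda>z. z0 \<circ> z) ` centralizer n w \<subseteq> {z \<in> ?B. z \<circ> w = y \<circ> z}"
      proof
        fix v assume "v \<in> (\<lambda>z. z0 \<circ> z) ` centralizer n w"
        then obtain z where z: "v = z0 \<circ> z" "z \<in> ?B" "z \<circ> w = w \<circ> z" by (auto simp: cent)
        have "v \<circ> w = y \<circ> v"
          using fun_cong[OF z(3)] zw unfolding z(1) by (simp add: fun_eq_iff)
        then show "v \<in> {z \<in> ?B. z \<circ> w = y \<circ> z}" using z z0 odd_perms_comp by auto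
      qed
      show "(\<lambda>z. Hilbert_Choice.inv z0 \<circ> z) ` {z \<in> ?B. z \<circ> w = y \<circ> z} \<subseteq> centralizer n w"
      proof
        fix v assume "v \<in> (\<lambda>z. Hilbert_Choice.inv z0 \<circ> z) ` {z \<in> ?B. z \<circ> w = y \<circ> z}"
        then obtain z where z: "v = Hilbert_Choice.inv z0 \<circ> z" "z \<in> ?B" "z \<circ> w = y \<circ> z" by auto
        have "Hilbert_Choice.inv z0 (y i) = w (Hilbert_Choice.inv z0 i)" for i
          using zw[of "Hilbert_Choice.inv z0 i"] permutes_inverses[OF odd_permsD(1)[OF z0(1)]] by metis
        then have "v \<circ> w = w \<circ> v"
          using fun_cong[OF z(3)] unfolding z(1) by (simp add: fun_eq_iff)
        then show "v \<in> centralizer n w"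
          using z z0 odd_perms_comp odd_perms_inv by (auto simp: cent)
      qed
    qed
    have "{z \<in> ?B. ?c z = y} = {z \<in> ?B. z \<circ> w = y \<circ> z}"
      by (rule Collect_cong, rule conj_cong[OF refl c_iff])
    then show ?thesis using bij_betw_same_card[OF bij] by simp
  qed
  have "int (card ?B) * F w = (\<Sum>z\<in>?B. F (?c z))"
    using F by simp
  also have "\<dots> = (\<Sum>y\<in>?K. \<Sum>z\<in>{z \<in> ?B. ?c z = y}. F (?c z))"
    by (rule sum.group[symmetric]) (use fin cK in auto)
  also have "\<dots> = (\<Sum>y\<in>?K. int (card (centralizer n w)) * F y)"
  proof (rule sum.cong[OF refl])
    fix y assume "y \<in> ?K"
    have "(\<Sum>z\<in>{z \<in> ?B. ?c z = y}. F (?c z)) = (\<Sum>z\<in>{z \<in> ?B. ?c z = y}. F y)"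
      by (rule sum.cong) auto
    then show "(\<Sum>z\<in>{z \<in> ?B. ?c z = y}. F (?c z)) = int (card (centralizer n w)) * F y"
      using fiber[OF \<open>y \<in> ?K\<close>] by simp
  qed
  finally show ?thesis by (simp add: sum_distrib_left)
qed

section \<open>The generating functions\<close>

lemma mps_var_power: "mps_var x ^ l = Abs_mps (\<lambda>m. if m = Poly_Mapping.single x l then 1 else (0 :: 'a :: comm_ring_1))"
proof (induction l)
  case 0
  show ?case by (rule mps_eqI) (simp add: mps_coeff_one)
next
  case (Suc l)
  show ?case
  proof (rule mps_eqI)
    fix m
    have split: "Poly_Mapping.single x (Suc l) = Poly_Mapping.single x 1 + Poly_Mapping.single x l"
      by (simp flip: single_add)
    have "mps_coeff (mps_var x * mps_var x ^ l) m
      = (\<Sum>p\<in>mono_splits m. if p = (Poly_Mapping.single x 1, Poly_Mapping.single x l) then 1 else (0 :: 'a))"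
      unfolding mps_coeff_mult Suc by (rule sum.cong) (auto simp: mps_var_def split: if_splits)
    also have "\<dots> = (if m = Poly_Mapping.single x (Suc l) then 1 else 0)"
      by (auto simp: split) (auto simp: mono_splits_def)
    finally show "mps_coeff (mps_var x ^ Suc l) m
      = mps_coeff (Abs_mps (\<lambda>m. if m = Poly_Mapping.single x (Suc l) then 1 else (0 :: 'a))) m"
      by simp
  qed
qed

lemma mps_coeff_var_power:
  "mps_coeff (mps_var x ^ l) m = (if m = Poly_Mapping.single x l then 1 else 0)"
  by (simp add: mps_var_power)

lemma mps_coeff_neg_one_power_mult: "mps_coeff ((- 1) ^ l * f) m = (- 1) ^ l * mps_coeff f m"
  by (cases "even l") simp_all

lemma hcomp_sum: "hcomp n (sum F I) = (\<Sum>i\<in>I. hcomp n (F i))"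
  by (rule mps_eqI) (simp add: mps_coeff_hcomp)

section \<open>The exponent, degree by degree\<close>

definition exponent_term :: "(nat \<Rightarrow> int \<Rightarrow> int) \<Rightarrow> nat \<Rightarrow> nat \<Rightarrow> int \<Rightarrow> nat \<Rightarrow> series" where
  "exponent_term r k j \<theta> h = mps_const (of_int (r h \<theta>) / (2 * of_nat j * of_nat k / of_nat h))
        * (- ((- t_var j \<theta>) ^ (j * (k div h))))"

lemma mps_coeff_exponent_term:
  "mps_coeff (exponent_term r k j \<theta> h) m \<noteq> 0 \<Longrightarrow> m = Poly_Mapping.single (j, \<theta>) (j * (k div h))"
  by (auto simp: exponent_term_def power_minus[of "mps_var _"] mps_coeff_neg_one_power_mult mps_coeff_var_power
    split: if_splits)

lemma hcomp_exponent_term: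
  "hcomp m (exponent_term r k j \<theta> h) = (if j * (k div h) = m then exponent_term r k j \<theta> h else 0)"
proof (rule mps_eqI)
  fix n
  show "mps_coeff (hcomp m (exponent_term r k j \<theta> h)) n
      = mps_coeff (if j * (k div h) = m then exponent_term r k j \<theta> h else 0) n"
    using mps_coeff_exponent_term[of r k j \<theta> h n]
    by (cases "mps_coeff (exponent_term r k j \<theta> h) n = 0") (auto simp: mps_coeff_hcomp)
qed

text \<open>The denominator 2 j k / h is twice the degree m of the term, so the factor 2 m on the
  left of the recursion clears it.\<close>

lemma exponent_term_eq:
  assumes "h dvd k" "0 < k" "0 < j" "j * (k div h) = m"
  shows "2 * of_nat m * exponent_term r k j \<theta> h = of_int (r h \<theta>) * (- ((- t_var j \<theta>) ^ m))"
proof -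
  obtain d where d: "k = h * d" using assms(1) by (elim dvdE)
  with assms have nz: "h \<noteq> 0" "d \<noteq> 0" "m = j * d" by auto
  have m: "2 * of_nat j * of_nat k / of_nat h = (of_nat (2 * m) :: complex)"
    using nz by (simp add: d)
  have "of_nat (2 * m) \<noteq> (0 :: complex)" using nz assms(3) by simp
  then have "of_nat (2 * m) * (of_int (r h \<theta>) / of_nat (2 * m)) = (of_int (r h \<theta>) :: complex)"
    by (simp del: of_nat_mult)
  then have "of_nat (2 * m) * mps_const (of_int (r h \<theta>) / of_nat (2 * m)) = (of_int (r h \<theta>) :: series)"
    by (metis mps_const_mult mps_const_of_int mps_const_of_nat)
  then have "(of_nat (2 * m) * mps_const (of_int (r h \<theta>) / of_nat (2 * m))) * (- ((- t_var j \<theta>) ^ m))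
      = of_int (r h \<theta>) * (- ((- t_var j \<theta>) ^ m))" by (rule arg_cong)
  then show ?thesis
    unfolding exponent_term_def m assms(4) by (simp only: of_nat_mult of_nat_numeral mult.assoc)
qed

lemma exponent_series_conv:
  "exponent_series r k = mps_sum (\<lambda>(j, \<theta>). \<Sum>h | h dvd k \<and> coprime h j. exponent_term r k j \<theta> h) ({1..} \<times> Z2)"
  by (simp add: exponent_series_def exponent_term_def)

text \<open>As \<open>k div h\<close> is at least 1, the terms of index j have degree at least j.
  The family in \<open>exponent_series\<close> is therefore locally finite, and j beyond
  \<open>mdeg m\<close> cannot contribute.\<close>

lemma mps_coeff_exponent_series:
  assumes "0 < k"
  shows "mps_coeff (exponent_series r k) m
    = mps_coeff (\<Sum>j=1..mdeg m. \<Sum>\<theta>\<in>Z2. \<Sum>h | h dvd k \<and> coprime h j. exponent_term r k j \<theta> h) m"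
proof -
  define F where "F = (\<lambda>(j, \<theta>). \<Sum>h | h dvd k \<and> coprime h j. exponent_term r k j \<theta> h)"
  have le: "j \<le> mdeg m" if "mps_coeff (F (j, \<theta>)) m \<noteq> 0" for j \<theta>
  proof -
    have "(\<Sum>h | h dvd k \<and> coprime h j. mps_coeff (exponent_term r k j \<theta> h) m) \<noteq> 0"
      using that by (simp add: F_def)
    then obtain h where h: "h dvd k" "mps_coeff (exponent_term r k j \<theta> h) m \<noteq> 0"
      by (rule sum.not_neutral_contains_not_neutral) auto
    have "0 < k div h" using h assms by (auto elim: dvdE)
    then have "j \<le> j * (k div h)" by simp
    then show ?thesis using mps_coeff_exponent_term[OF h(2)] by simp
  qed
  have "mps_coeff (exponent_series r k) m
      = (\<Sum>i\<in>{i \<in> {1..} \<times> Z2. mps_coeff (F i) m \<noteq> 0}. mps_coeff (F i) m)"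
    by (simp add: exponent_series_conv mps_sum_def F_def)
  also have "\<dots> = (\<Sum>i\<in>{1..mdeg m} \<times> Z2. mps_coeff (F i) m)"
    by (rule sum.mono_neutral_left) (use le in \<open>auto simp: Z2_def\<close>)
  also have "\<dots> = mps_coeff (\<Sum>j=1..mdeg m. \<Sum>\<theta>\<in>Z2. F (j, \<theta>)) m"
    by (simp add: sum.cartesian_product case_prod_unfold)
  finally show ?thesis by (simp add: F_def)
qed

lemma exponent_series_coeff_0: "0 < k \<Longrightarrow> mps_coeff (exponent_series r k) 0 = 0"
  by (simp add: mps_coeff_exponent_series)

text \<open>
  A signed cycle of length \<open>m\<close> and class \<open>\<epsilon>\<close> contributes its \<open>k\<close>-th power, which consists of \<open>gcd m k\<close>
  signed cycles of length \<open>j = m / gcd m k\<close> and class \<open>\<epsilon>\<^sup>h\<close>, where \<open>h = k / gcd m k\<close>. Thus \<open>h\<close> is a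
  divisor of \<open>k\<close> coprime to \<open>j\<close> with \<open>m = j k / h\<close>, and \<open>(j, h)\<close> is determined by \<open>m\<close>.
\<close>

lemma cycle_power_params:
  fixes j h k m :: nat
  assumes "0 < k" "0 < m"
  shows "h dvd k \<and> coprime h j \<and> j * (k div h) = m \<longleftrightarrow> j = m div gcd m k \<and> h = k div gcd m k"
proof
  assume *: "h dvd k \<and> coprime h j \<and> j * (k div h) = m"
  then obtain d where d: "k = h * d" by (auto elim: dvdE)
  with assms have pos: "0 < h" "0 < d" by auto
  with * d have m: "m = j * d" by auto
  have "gcd j h = 1" using * by (simp add: coprime_iff_gcd_eq_1 gcd.commute)
  then have "gcd m k = d" by (simp add: m d gcd_mult_right gcd_mult_distrib_nat[symmetric] mult.commute[of _ d])
  then show "j = m div gcd m k \<and> h = k div gcd m k" using pos by (simp add: m d)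
next
  assume *: "j = m div gcd m k \<and> h = k div gcd m k"
  define g where "g = gcd m k"
  obtain a b where ab: "m = a * g" "k = b * g" "coprime a b"
    using gcd_coprime_exists[of m k] assms unfolding g_def by auto
  have g: "0 < g" using assms by (simp add: g_def)
  have "j = a" "h = b" using * g unfolding g_def[symmetric] by (simp_all add: ab(1,2))
  moreover have "0 < b" using ab(2) assms by (intro gr0I) auto
  ultimately show "h dvd k \<and> coprime h j \<and> j * (k div h) = m"
    using ab(3) by (simp add: ab(1,2) coprime_commute)
qed

text \<open>Common form of the two root functions: s = 1 gives \<open>roots_Z2\<close>, and s = -1
  gives \<open>sroots_Z2\<close> because \<epsilon> then has weight \<epsilon>. Here s is the value
  of the character at a sign change.\<close>

definition root_weight :: "int \<Rightarrow> nat \<Rightarrow> int \<Rightarrow> int" where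
  "root_weight s h \<theta> = (\<Sum>\<epsilon> | \<epsilon> \<in> Z2 \<and> \<epsilon> ^ h = \<theta>. if \<epsilon> = 1 then 1 else s)"

text \<open>\<open>ctype_power\<close> as a substitution: a point on a cycle of type (m, \<epsilon>)
  of x carries this variable in the cycle monomial of \<open>x ^^ k\<close>.\<close>

definition power_var :: "nat \<Rightarrow> nat \<times> int \<Rightarrow> series" where
  "power_var k = (\<lambda>(m, \<epsilon>). t_var (m div gcd m k) (\<epsilon> ^ (k div gcd m k)))"

text \<open>By \<open>cycle_power_params\<close> a single pair (j, h) survives in degree m. Summing
  over \<theta> and then over the h-th roots of \<theta> is summing over all \<epsilon> in Z2, the
  two possible classes of a cycle of length m.\<close>

lemma hcomp_exponent_series:
  assumes k: "0 < k" and m: "0 < m"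
  shows "2 * of_nat m * hcomp m (exponent_series (root_weight s) k)
    = (\<Sum>\<epsilon>\<in>Z2. of_int (if \<epsilon> = 1 then 1 else s) * (- ((- power_var k (m, \<epsilon>)) ^ m)))"
proof -
  let ?r = "root_weight s"
  let ?H = "\<lambda>j. {h. h dvd k \<and> coprime h j}"
  define j0 where "j0 = m div gcd m k"
  define h0 where "h0 = k div gcd m k"
  have finH: "finite (?H j)" for j using k by simp
  have jh: "h0 dvd k" "coprime h0 j0" "j0 * (k div h0) = m"
    using cycle_power_params[OF k m, of h0 j0] by (simp_all add: j0_def h0_def)
  then have j0: "0 < j0" "j0 \<le> m" using m by (auto intro: gr0I simp: j0_def)
  let ?X = "\<lambda>j \<theta> h. of_int (?r h \<theta>) * (- ((- t_var j \<theta>) ^ m))"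
  have inner: "(\<Sum>h\<in>?H j. 2 * of_nat m * hcomp m (exponent_term ?r k j \<theta> h)) = (if j = j0 then ?X j0 \<theta> h0 else 0)"
    if j: "0 < j" for j \<theta>
  proof -
    have "(\<Sum>h\<in>?H j. 2 * of_nat m * hcomp m (exponent_term ?r k j \<theta> h))
        = (\<Sum>h\<in>?H j. if h = h0 then (if j = j0 then ?X j0 \<theta> h0 else 0) else 0)"
    proof (rule sum.cong[OF refl])
      fix h assume "h \<in> ?H j"
      then have "j * (k div h) = m \<longleftrightarrow> j = j0 \<and> h = h0"
        using cycle_power_params[OF k m, of h j] by (auto simp: j0_def h0_def)
      then show "2 * of_nat m * hcomp m (exponent_term ?r k j \<theta> h)
          = (if h = h0 then (if j = j0 then ?X j0 \<theta> h0 else 0) else 0)"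
        using exponent_term_eq[OF jh(1) k j0(1) jh(3)] by (auto simp: hcomp_exponent_term)
    qed
    then show ?thesis using finH[of j] jh by (auto simp: sum.delta)
  qed
  have "hcomp m (exponent_series ?r k)
      = hcomp m (\<Sum>j=1..m. \<Sum>\<theta>\<in>Z2. \<Sum>h\<in>?H j. exponent_term ?r k j \<theta> h)"
    by (rule mps_eqI) (auto simp: mps_coeff_hcomp mps_coeff_exponent_series[OF k])
  then have "2 * of_nat m * hcomp m (exponent_series ?r k)
      = (\<Sum>j=1..m. \<Sum>\<theta>\<in>Z2. \<Sum>h\<in>?H j. 2 * of_nat m * hcomp m (exponent_term ?r k j \<theta> h))"
    by (simp add: hcomp_sum sum_distrib_left)
  also have "\<dots> = (\<Sum>j=1..m. \<Sum>\<theta>\<in>Z2. if j = j0 then ?X j0 \<theta> h0 else 0)"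
    by (intro sum.cong refl) (auto simp: inner)
  also have "\<dots> = (\<Sum>j=1..m. if j = j0 then (\<Sum>\<theta>\<in>Z2. ?X j0 \<theta> h0) else 0)"
    by (intro sum.cong refl) auto
  also have "\<dots> = (\<Sum>\<theta>\<in>Z2. ?X j0 \<theta> h0)"
    using j0 by (subst sum.delta) auto
  also have "\<dots> = (\<Sum>\<theta>\<in>Z2. \<Sum>\<epsilon>\<in>{\<epsilon> \<in> Z2. \<epsilon> ^ h0 = \<theta>}.
      of_int (if \<epsilon> = 1 then 1 else s) * (- ((- power_var k (m, \<epsilon>)) ^ m)))"
  proof (rule sum.cong[OF refl])
    fix \<theta>
    have "?X j0 \<theta> h0 = (\<Sum>\<epsilon>\<in>{\<epsilon> \<in> Z2. \<epsilon> ^ h0 = \<theta>}. of_int (if \<epsilon> = 1 then 1 else s) * (- ((- t_var j0 \<theta>) ^ m)))"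
      by (simp only: root_weight_def of_int_sum sum_distrib_right)
    also have "\<dots> = (\<Sum>\<epsilon>\<in>{\<epsilon> \<in> Z2. \<epsilon> ^ h0 = \<theta>}.
      of_int (if \<epsilon> = 1 then 1 else s) * (- ((- power_var k (m, \<epsilon>)) ^ m)))"
      by (rule sum.cong) (auto simp: power_var_def j0_def h0_def)
    finally show "?X j0 \<theta> h0 = (\<Sum>\<epsilon>\<in>{\<epsilon> \<in> Z2. \<epsilon> ^ h0 = \<theta>}.
      of_int (if \<epsilon> = 1 then 1 else s) * (- ((- power_var k (m, \<epsilon>)) ^ m)))" .
  qed
  also have "\<dots> = (\<Sum>\<epsilon>\<in>Z2. of_int (if \<epsilon> = 1 then 1 else s) * (- ((- power_var k (m, \<epsilon>)) ^ m)))"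
    by (rule sum.group) (auto simp: Z2_power Z2_def[symmetric], simp_all add: Z2_def)
  finally show ?thesis .
qed

section \<open>Sums of a character over k-th roots\<close>

definition root_sum :: "(nat \<Rightarrow> (int \<Rightarrow> int) \<Rightarrow> int) \<Rightarrow> nat \<Rightarrow> nat \<Rightarrow> (int \<Rightarrow> int) \<Rightarrow> int" where
  "root_sum f k n y = (\<Sum>x | x \<in> odd_perms (signed_points n) \<and> x ^^ k = y. f n x)"

text \<open>Conjugation by \<open>z\<close> carries the k-th roots of \<open>y\<close> to those of
  its conjugate and preserves a linear character. This is the invariance that
  \<open>sum_class\<close> requires.\<close>

lemma root_sum_conj:
  assumes "signed_char (signed_points n) (f n) r s" and z: "z \<in> odd_perms (signed_points n)"
  shows "root_sum f k n (z \<circ> y \<circ> Hilbert_Choice.inv z) = root_sum f k n y"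
proof -
  interpret signed_char "signed_points n" "f n" r s by fact
  let ?B = "odd_perms (signed_points n)" and ?z = "Hilbert_Choice.inv z"
  have inv: "?z (z i) = i" "z (?z i) = i" for i
    using permutes_inverses[OF odd_permsD(1)[OF z]] by auto
  have z': "?z \<in> ?B" using z by (rule odd_perms_inv)
  have pow: "((z \<circ> x \<circ> ?z) ^^ k) = z \<circ> x ^^ k \<circ> ?z" for x
  proof
    fix i
    show "((z \<circ> x \<circ> ?z) ^^ k) i = (z \<circ> x ^^ k \<circ> ?z) i"
      by (induction k) (simp_all add: inv)
  qed
  have cancel: "z \<circ> (?z \<circ> x \<circ> z) \<circ> ?z = x" "?z \<circ> (z \<circ> x \<circ> ?z) \<circ> z = x" for x
    by (auto simp: inv)
  show ?thesis
    unfolding root_sum_def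
  proof (rule sum.reindex_bij_witness[where i = "\<lambda>x. z \<circ> x \<circ> ?z" and j = "\<lambda>x. ?z \<circ> x \<circ> z"], goal_cases)
    case (1 x)
    show ?case by (rule cancel)
  next
    case (2 x)
    then have x: "x \<in> ?B" "x ^^ k = z \<circ> y \<circ> ?z" by auto
    have "z \<circ> (?z \<circ> x \<circ> z) ^^ k \<circ> ?z = z \<circ> y \<circ> ?z"
      using pow[of "?z \<circ> x \<circ> z"] unfolding cancel x(2) by simp
    then have "(?z \<circ> x \<circ> z) ^^ k = y"
      using cancel(2) by metis
    then show ?case using x(1) z z' by (auto intro!: odd_perms_comp)
  next
    case (3 x)
    show ?case by (rule cancel)
  next
    case (4 x)
    then show ?case using z z' pow by (auto intro!: odd_perms_comp)
  next
    case (5 x)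
    then have x: "?z \<circ> x \<circ> z \<in> ?B" using z z' by (auto intro!: odd_perms_comp)
    from g_conj[OF z x] show ?case by (simp only: cancel)
  qed
qed

lemma mps_of_nat_cancel:
  fixes F G :: "('v, 'a :: field_char_0) mps"
  assumes "of_nat N * F = of_nat N * G" "N \<noteq> 0"
  shows "F = G"
proof (rule mps_eqI)
  fix m
  have "mps_coeff (of_nat N * F) m = mps_coeff (of_nat N * G) m" unfolding assms(1) ..
  then show "mps_coeff F m = mps_coeff G m" using assms(2) by simp
qed

lemma of_nat_mult_mps_const_divide:
  assumes "int z * v = int b * u" "z \<noteq> 0"
  shows "of_nat b * mps_const (of_int u / of_nat z) = (of_int v :: series)"
proof -
  have "of_nat z * of_int v = (of_nat b * of_int u :: complex)"
    using arg_cong[OF assms(1), of "of_int :: int \<Rightarrow> complex"] by simp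
  then have "of_nat b * (of_int u / of_nat z) = (of_int v :: complex)"
    using assms(2) by (simp add: field_simps)
  then have "mps_const (of_nat b * (of_int u / of_nat z)) = (mps_const (of_int v) :: series)"
    by (rule arg_cong)
  then show ?thesis by (simp only: mps_const_mult mps_const_of_int mps_const_of_nat)
qed

theorem class_series_root_sum:
  assumes char: "\<And>n. signed_char (signed_points n) (f n) (- 1) s" and k: "0 < k"
  shows "class_series (root_sum f k) = mps_exp (exponent_series (root_weight s) k)"
proof -
  define G where "G = exponent_series (root_weight s) k"
  define E where "E n = hcomp n (mps_exp G)" for n
  let ?F = "root_sum f k"
  let ?coef = "\<lambda>n \<mu>. of_int (?F n (class_rep n \<mu>)) / of_nat (card (centralizer n (class_rep n \<mu>))) :: complex"
  define A where "A n = (\<Sum>\<mu>\<in>bipartitions n. mps_const (?coef n \<mu>) * t_monom \<mu>)" for n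
  have G0: "mps_coeff G 0 = 0" unfolding G_def using k by (rule exponent_series_coeff_0)
  have A: "A n = E n" for n
  proof -
    let ?S = "signed_points n" and ?B = "odd_perms (signed_points n)"
    have S: "sym_set ?S" by (rule sym_set_signed_points)
    have finB: "finite ?B" using S by (simp add: sym_set_def finite_odd_perms)
    have cardS: "card (pos_part ?S) = n" by (simp add: pos_part_signed_points)
    have cardB: "card ?B = 2 ^ n * fact n" using S cardS by (rule card_odd_perms)
    interpret signed_char ?S "f n" "- 1" s by (rule char)
    interpret w: weighted_signed_char ?S "\<lambda>w. of_int (f n w) :: series" "- 1" "of_int s" "power_var k"
      using signed_char_of_int[OF char[of n]] by (simp add: weighted_signed_char_def)
    \<comment> \<open>Group order over centralizer order is the class size, so multiplying by the
      group order turns the coefficient into a sum over the elements of the class.\<close>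
    have class_sum: "of_nat (card ?B) * mps_const (?coef n \<mu>) = (of_int (\<Sum>y | y \<in> ?B \<and> cycle_type n y = \<mu>. ?F n y) :: series)"
      if \<mu>: "\<mu> \<in> bipartitions n" for \<mu>
    proof -
      let ?y = "class_rep n \<mu>" and ?Z = "centralizer n (class_rep n \<mu>)"
      note rep = class_rep[OF \<mu>]
      have "id \<in> ?Z" "finite ?Z"
        using finB by (auto simp: centralizer_def carrier_hyperoctahedral hyperoctahedral_def odd_perms_def permutes_id
          intro: rev_finite_subset)
      then have Z: "card ?Z \<noteq> 0" by auto
      have conj: "?F n (z \<circ> ?y \<circ> Hilbert_Choice.inv z) = ?F n ?y" if "z \<in> ?B" for z
        using char that by (rule root_sum_conj)
      have "int (card ?Z) * (\<Sum>y | y \<in> ?B \<and> cycle_type n y = \<mu>. ?F n y) = int (card ?B) * ?F n ?y"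
        using sum_class[OF rep(1), of "?F n", OF conj] unfolding rep(2) .
      then show ?thesis using Z by (rule of_nat_mult_mps_const_divide)
    qed
    have "of_nat (card ?B) * A n = (\<Sum>\<mu>\<in>bipartitions n. (of_nat (card ?B) * mps_const (?coef n \<mu>)) * t_monom \<mu>)"
      by (simp add: A_def sum_distrib_left mult.assoc)
    also have "\<dots> = (\<Sum>\<mu>\<in>bipartitions n. \<Sum>y\<in>{y \<in> ?B. cycle_type n y = \<mu>}. of_int (?F n y) * t_monom (cycle_type n y))"
    proof (rule sum.cong[OF refl])
      fix \<mu> assume \<mu>: "\<mu> \<in> bipartitions n"
      show "of_nat (card ?B) * mps_const (?coef n \<mu>) * t_monom \<mu>
          = (\<Sum>y\<in>{y \<in> ?B. cycle_type n y = \<mu>}. of_int (?F n y) * t_monom (cycle_type n y))"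
        unfolding class_sum[OF \<mu>] by (simp add: sum_distrib_right)
    qed
    also have "\<dots> = (\<Sum>y\<in>?B. of_int (?F n y) * t_monom (cycle_type n y))"
      by (rule sum.group) (use finB finite_bipartitions cycle_type_in_bipartitions in auto)
    \<comment> \<open>Each x is a k-th root of exactly one y, so the double sum over y and its roots
      collapses to a sum over x, with \<open>x ^^ k\<close> in place of y.\<close>
    also have "\<dots> = (\<Sum>y\<in>?B. \<Sum>x\<in>{x \<in> ?B. x ^^ k = y}. of_int (f n x) * t_monom (cycle_type n (x ^^ k)))"
      by (rule sum.cong) (simp_all add: root_sum_def sum_distrib_right)
    also have "\<dots> = (\<Sum>x\<in>?B. of_int (f n x) * t_monom (cycle_type n (x ^^ k)))"
      by (rule sum.group) (use finB odd_perms_funpow in auto)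
    also have "\<dots> = (\<Sum>x\<in>?B. w.weight ?S x)"
    proof (rule sum.cong[OF refl])
      fix x assume x: "x \<in> ?B"
      have "t_monom (cycle_type n (x ^^ k)) = (\<Prod>i\<in>pos_part ?S. mps_var (ctype (x ^^ k) i))"
        by (rule t_monom_cycle_type[OF odd_perms_funpow[OF x]])
      also have "\<dots> = (\<Prod>i\<in>pos_part ?S. power_var k (ctype x i))"
      proof (rule prod.cong[OF refl])
        fix i assume "i \<in> pos_part ?S"
        then have i: "i \<in> ?S" by (simp add: pos_part_def)
        show "mps_var (ctype (x ^^ k) i) = power_var k (ctype x i)"
          unfolding ctype_power[OF S x i k] by (simp add: power_var_def ctype_def)
      qed
      finally show "of_int (f n x) * t_monom (cycle_type n (x ^^ k)) = w.weight ?S x"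
        by (simp add: w.weight_def)
    qed
    also have "\<dots> = of_nat (2 ^ n * fact n) * E n"
    proof (rule w.sum_weight[OF _ _ S order_refl cardS])
      show "E 0 = 1" unfolding E_def using G0 by (rule hcomp_exp_0)
      fix n
      have cw: "2 * of_nat m * hcomp m G = w.cycle_weight m 1 + w.cycle_weight m (- 1)" if m: "m \<in> {1..n}" for m
      proof -
        obtain d where d: "m = Suc d" using m by (cases m) auto
        have "- ((- t) ^ m) = (- 1) ^ (m - 1) * t ^ m" for t :: series
          by (simp add: d power_minus[of t])
        then show ?thesis
          using hcomp_exponent_series[OF k, of m s] m
          by (simp add: G_def w.cycle_weight_def Z2_def mult_ac)
      qed
      have "2 * of_nat n * E n = 2 * (of_nat n * hcomp n (mps_exp G))" by (simp add: E_def)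
      also have "\<dots> = (\<Sum>m=1..n. 2 * of_nat m * hcomp m G * E (n - m))"
        unfolding hcomp_exp_rec[OF G0] by (simp add: sum_distrib_left E_def mult.assoc)
      also have "\<dots> = (\<Sum>m=1..n. (w.cycle_weight m 1 + w.cycle_weight m (- 1)) * E (n - m))"
        by (rule sum.cong) (simp_all add: cw)
      finally show "2 * of_nat n * E n = (\<Sum>m=1..n. (w.cycle_weight m 1 + w.cycle_weight m (- 1)) * E (n - m))" .
    qed
    finally show ?thesis
      unfolding cardB by (rule mps_of_nat_cancel) simp
  qed
  have "class_series ?F = mps_sum E UNIV"
    by (simp add: class_series_def A_def[symmetric] A)
  also have "\<dots> = mps_exp G"
  proof (rule mps_eqI)
    fix m
    \<comment> \<open>\<open>E n\<close> is homogeneous of degree n, so only n =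
      \<open>mdeg m\<close> can contribute to the coefficient at m.\<close>
    have "{n. mps_coeff (E n) m \<noteq> 0} = (if mps_coeff (mps_exp G) m = 0 then {} else {mdeg m})"
      by (auto simp: E_def mps_coeff_hcomp)
    then show "mps_coeff (mps_sum E UNIV) m = mps_coeff (mps_exp G) m"
      by (simp add: mps_sum_def E_def mps_coeff_hcomp)
  qed
  finally show ?thesis by (simp add: G_def)
qed

lemma roots'_eq: "roots' k = root_sum chi' k"
  by (intro ext) (simp add: roots'_def root_sum_def hyperoctahedral_pow carrier_hyperoctahedral)

lemma sroots'_eq: "sroots' k = root_sum (\<lambda>n w. chi n w * chi' n w) k"
  by (intro ext) (simp add: sroots'_def root_sum_def hyperoctahedral_pow carrier_hyperoctahedral)

lemma roots_Z2_eq: "roots_Z2 = root_weight 1"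
  by (intro ext) (simp add: roots_Z2_def root_weight_def)

lemma sroots_Z2_eq: "sroots_Z2 = root_weight (- 1)"
  by (intro ext) (auto simp: sroots_Z2_def root_weight_def Z2_iff intro!: sum.cong)

theorem theorem7p9:
  fixes k :: nat
  assumes "k > 0"
  shows "class_series (roots' k) = mps_exp (exponent_series roots_Z2 k)
       \<and> class_series (sroots' k) = mps_exp (exponent_series sroots_Z2 k)"
  using class_series_root_sum[OF signed_char_chi' assms]
    \<comment> \<open>\<open>chi\<close> has r = 1, s = -1 and \<open>chi'\<close> has r = -1, s =
      1, so their product has r = s = -1.\<close>
    class_series_root_sum[OF signed_char_mult[OF signed_char_chi signed_char_chi', simplified] assms]
  by (simp add: roots'_eq sroots'_eq roots_Z2_eq sroots_Z2_eq)

end
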